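(* Let $n$ be odd and let $f$ be an $n$-ary quasigroup of order $4$. Then $f$ has at least $8^{n-1}$ transversals.
   Context: Let $\Sigma_q=\{0,\dots,q-1\}$. An $n$-ary quasigroup of order $q$ is a map $f:\Sigma_q^n\to\Sigma_q$ such that the equation $x_0=f(x_1,\dots,x_n)$ has a unique solution in any one of the variables $x_0,\dots,x_n$ when the other $n$ variables are fixed arbitrarily. A transversal in $f$ is a set of $q$ vectors $\alpha^i=(a^i_0,\dots,a^i_n)\in\Sigma_q^{n+1}$, $i=1,\dots,q$, such that $a^i_0=f(a^i_1,\dots,a^i_n)$ for all $i$ and $a^i_k\neq a^j_k$ for all $i\neq j$ and all $k\in\{0,\dots,n\}$. *)

theory Defs
  imports Main
begin

text \<open>
  Elements of \<open>\<Sigma>\<^sub>q\<^sup>m\<close> are lists of length \<open>m\<close>. A vector \<open>(x\<^sub>0, x\<^sub>1, \<dots>, x\<^sub>n)\<close> is a list \<open>\<alpha>\<close> of length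
  \<open>n + 1\<close> with \<open>x\<^sub>k = \<alpha> ! k\<close>, so that \<open>x\<^sub>0 = f(x\<^sub>1, \<dots>, x\<^sub>n)\<close> reads \<open>\<alpha> ! 0 = f (tl \<alpha>)\<close>.
  Values of \<open>f\<close> outside \<open>\<Sigma>\<^sub>q\<^sup>n\<close> are irrelevant.
\<close>

definition words :: "nat \<Rightarrow> nat \<Rightarrow> nat list set" where
  "words q m = {xs. length xs = m \<and> set xs \<subseteq> {0..<q}}"

definition graph_vector :: "(nat list \<Rightarrow> nat) \<Rightarrow> nat list \<Rightarrow> bool" where
  "graph_vector f \<alpha> \<longleftrightarrow> \<alpha> ! 0 = f (tl \<alpha>)"

definition quasigroup :: "nat \<Rightarrow> nat \<Rightarrow> (nat list \<Rightarrow> nat) \<Rightarrow> bool" where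
  "quasigroup q n f \<longleftrightarrow>
     (\<forall>xs \<in> words q n. f xs \<in> {0..<q}) \<and>
     (\<forall>k \<in> {0..n}. \<forall>\<alpha> \<in> words q (n + 1). \<exists>!x. x \<in> {0..<q} \<and> graph_vector f (\<alpha>[k := x]))"

definition transversal :: "nat \<Rightarrow> nat \<Rightarrow> (nat list \<Rightarrow> nat) \<Rightarrow> nat list set \<Rightarrow> bool" where
  "transversal q n f T \<longleftrightarrow>
     T \<subseteq> words q (n + 1) \<and> card T = q \<and>
     (\<forall>\<alpha> \<in> T. graph_vector f \<alpha>) \<and>
     (\<forall>\<alpha> \<in> T. \<forall>\<beta> \<in> T. \<alpha> \<noteq> \<beta> \<longrightarrow> (\<forall>k \<in> {0..n}. \<alpha> ! k \<noteq> \<beta> ! k))"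

end

theory Submission
  imports Defs "HOL-Library.FuncSet" "HOL-Combinatorics.Permutations"
begin

text \<open>
  Identify the symbols with the Klein group \<open>V\<close>. Through every point \<open>x\<close> and any two directions \<open>i\<close>,
  \<open>j\<close> passes a Latin square of order 4. Labelling the points of a line by the increments of \<open>f\<close>, it
  becomes one of four normalised squares, described by a colour \<open>col i j x \<in> V\<close>: \<open>0\<close> for the Klein group,
  \<open>d \<noteq> 0\<close> for the cyclic group with involution \<open>d\<close>. At a fixed \<open>x\<close> the colours contain no rainbow
  triangle. For \<open>b \<noteq> 0\<close> join \<open>i\<close> and \<open>j\<close> if their colour is, at some \<open>x\<close>, different from \<open>0\<close> and \<open>b\<close>.

  The key fact is that for some \<open>b\<close> this graph is disconnected. If it is connected for all \<open>b\<close>, then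
  the points at which \<open>f\<close> lies in a fixed coset of \<open>{0, b}\<close> are connected by moves that
  change one coordinate and increase \<open>f\<close> by \<open>b\<close>. Such moves preserve the edges of colour \<open>b\<close> between
  different local components, which carries local information from one point to all others; by
  induction all faces of codimension one are disconnected for the same label \<open>b\<close>, and then so
  is the whole graph.

  If the graph of label \<open>b\<close> has no edges, then \<open>f\<close> is semilinear, and combining affine permutations of the
  coordinates which preserve the cosets of \<open>{0, b}\<close> gives \<open>8 ^ (n - 1)\<close> transversals for odd \<open>n\<close>.
  Otherwise a nontrivial component \<open>W\<close> splits off: \<open>f\<close> is a composition \<open>g (h x\<^sub>W, x\<^sub>J)\<close>. If \<open>|W|\<close> is
  odd, transversals of \<open>h\<close> and \<open>g\<close> are combined. If \<open>|W|\<close> is even, one uses families on which \<open>h\<close>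
  is constant: with 4 values and 24 matchings they give the factor \<open>96 \<ge> 8\<^sup>2\<close>.
\<close>

section \<open>The Klein group and Latin squares of order 4\<close>

datatype v4 = V0 | V1 | V2 | V3

instantiation v4 :: ab_group_add
begin

definition zero_v4 :: v4 where "zero_v4 = V0"

definition uminus_v4 :: "v4 \<Rightarrow> v4" where "uminus_v4 a = a"

fun plus_v4 :: "v4 \<Rightarrow> v4 \<Rightarrow> v4" where
  "plus_v4 V0 b = b"
| "plus_v4 a V0 = a"
| "plus_v4 V1 V1 = V0" | "plus_v4 V1 V2 = V3" | "plus_v4 V1 V3 = V2"
| "plus_v4 V2 V1 = V3" | "plus_v4 V2 V2 = V0" | "plus_v4 V2 V3 = V1"
| "plus_v4 V3 V1 = V2" | "plus_v4 V3 V2 = V1" | "plus_v4 V3 V3 = V0"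

definition minus_v4 :: "v4 \<Rightarrow> v4 \<Rightarrow> v4" where "minus_v4 a b = a + b"

instance
proof
  fix a b c :: v4
  show "a + b + c = a + (b + c)" by (cases a; cases b; cases c) simp_all
  show "a + b = b + a" by (cases a; cases b) simp_all
  show "0 + a = a" by (cases a) (simp_all add: zero_v4_def)
  show "- a + a = 0" by (cases a) (simp_all add: zero_v4_def uminus_v4_def)
  show "a - b = a + - b" by (simp add: minus_v4_def uminus_v4_def)
qed

end

lemma all_v4: "(\<forall>x. P x) \<longleftrightarrow> P V0 \<and> P V1 \<and> P V2 \<and> P V3"
  by (metis v4.exhaust)

lemma ex_v4: "(\<exists>x. P x) \<longleftrightarrow> P V0 \<or> P V1 \<or> P V2 \<or> P V3"
  by (metis v4.exhaust)

lemma UNIV_v4: "(UNIV :: v4 set) = {V0, V1, V2, V3}"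
  using v4.exhaust by blast

instance v4 :: finite
  by standard (simp add: UNIV_v4)

lemma card_v4: "card (UNIV :: v4 set) = 4"
  by (simp add: UNIV_v4)

lemma v4_add_self [simp]: "(a::v4) + a = 0"
  by (cases a) (simp_all add: zero_v4_def)

lemma v4_add_self_left [simp]: "(a::v4) + (a + b) = b"
  by (simp add: add.assoc [symmetric])

lemma v4_add_eq_0_iff [simp]: "(a::v4) + b = 0 \<longleftrightarrow> a = b"
  by (metis add.right_neutral v4_add_self v4_add_self_left)

text \<open>For \<open>b \<noteq> 0\<close> this is the linear functional on \<open>\<bbbZ>\<^sub>2 \<times> \<bbbZ>\<^sub>2\<close> with kernel \<open>{0, b}\<close>.\<close>

definition off :: "v4 \<Rightarrow> v4 \<Rightarrow> bool" where
  "off b v \<longleftrightarrow> v \<noteq> 0 \<and> v \<noteq> b"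

lemma off_add: "b \<noteq> 0 \<Longrightarrow> off b (u + v) \<longleftrightarrow> off b u \<noteq> off b v"
  by (cases b; cases u; cases v) (simp_all add: off_def zero_v4_def)

lemma off_0 [simp]: "\<not> off b 0"
  by (simp add: off_def)

lemma off_self [simp]: "\<not> off b b"
  by (simp add: off_def)

lemma ex_off: "\<exists>c. off b c"
  by (cases b) (simp_all add: off_def ex_v4 zero_v4_def)

text \<open>The four normalised Latin squares of order 4: \<open>lam 0\<close> is the Klein group, and \<open>lam d\<close> for
  \<open>d \<noteq> 0\<close> is the cyclic group in which \<open>d\<close> is the element of order 2.\<close>

definition lam :: "v4 \<Rightarrow> v4 \<Rightarrow> v4 \<Rightarrow> v4" where
  "lam d a b = (if d \<noteq> 0 \<and> off d a \<and> off d b then a + b + d else a + b)"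

text \<open>Moving the base point of a square of colour \<open>d\<close> by \<open>c\<close> along
  one direction relabels the lines of the other direction: the coordinate with increment
  \<open>b\<close> before the move has increment \<open>tw d c b\<close> after it (see
  \<open>val_mv_tw\<close>).\<close>

definition tw :: "v4 \<Rightarrow> v4 \<Rightarrow> v4 \<Rightarrow> v4" where
  "tw d c b = lam d c b + c"

lemma lam_table:
  "lam V0 a b = a + b" "lam V1 V0 b = b" "lam V1 V1 b = V1 + b" "lam V1 V2 V0 = V2"
  "lam V1 V2 V1 = V3" "lam V1 V2 V2 = V1" "lam V1 V2 V3 = V0" "lam V1 V3 V0 = V3"
  "lam V1 V3 V1 = V2" "lam V1 V3 V2 = V0" "lam V1 V3 V3 = V1" "lam V2 V0 b = b"
  "lam V2 V2 b = V2 + b" "lam V2 V1 V0 = V1" "lam V2 V1 V1 = V2" "lam V2 V1 V2 = V3"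
  "lam V2 V1 V3 = V0" "lam V2 V3 V0 = V3" "lam V2 V3 V1 = V0" "lam V2 V3 V2 = V1"
  "lam V2 V3 V3 = V2" "lam V3 V0 b = b" "lam V3 V3 b = V3 + b" "lam V3 V1 V0 = V1"
  "lam V3 V1 V1 = V3" "lam V3 V1 V2 = V0" "lam V3 V1 V3 = V2" "lam V3 V2 V0 = V2"
  "lam V3 V2 V1 = V0" "lam V3 V2 V2 = V3" "lam V3 V2 V3 = V1"
  by (simp_all add: lam_def off_def zero_v4_def)

lemma tw_table:
  "tw V0 c b = b" "tw V1 V0 b = b" "tw V1 V1 b = b" "tw V1 V2 V0 = V0" "tw V1 V2 V1 = V1"
  "tw V1 V2 V2 = V3" "tw V1 V2 V3 = V2" "tw V1 V3 V0 = V0" "tw V1 V3 V1 = V1" "tw V1 V3 V2 = V3"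
  "tw V1 V3 V3 = V2" "tw V2 V0 b = b" "tw V2 V2 b = b" "tw V2 V1 V0 = V0" "tw V2 V1 V1 = V3"
  "tw V2 V1 V2 = V2" "tw V2 V1 V3 = V1" "tw V2 V3 V0 = V0" "tw V2 V3 V1 = V3" "tw V2 V3 V2 = V2"
  "tw V2 V3 V3 = V1" "tw V3 V0 b = b" "tw V3 V3 b = b" "tw V3 V1 V0 = V0" "tw V3 V1 V1 = V2"
  "tw V3 V1 V2 = V1" "tw V3 V1 V3 = V3" "tw V3 V2 V0 = V0" "tw V3 V2 V1 = V2" "tw V3 V2 V2 = V1"
  "tw V3 V2 V3 = V3"
  by (cases c; cases b; simp add: tw_def lam_table zero_v4_def)+

lemma lam_commute: "lam d a b = lam d b a"
  by (simp add: lam_def add.commute conj_commute)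

lemma lam_0 [simp]: "lam d a 0 = a" "lam d 0 b = b"
  by (simp_all add: lam_def)

lemma tw_tw [simp]: "tw d c (tw d c b) = b"
  by (cases d; cases c; cases b) (simp_all add: tw_table)

text \<open>Renormalising \<open>lam d\<close> at another point of its first axis gives
  \<open>lam d\<close> again, up to the relabelling \<open>tw\<close>. Hence a colour belongs to a
  whole square and not to its base point (\<open>col_upd\<close>).\<close>

lemma lam_shift: "lam d (a + c) b = c + lam d a (tw d c b)"
  by (cases d; cases c; cases b; cases a) (simp_all add: tw_table lam_table zero_v4_def)

lemma lam_inj: "lam d = lam d' \<Longrightarrow> d = d'"
proof -
  assume "lam d = lam d'"
  then have "\<forall>a b. lam d a b = lam d' a b" by simp
  then show ?thesis
    by (cases d; cases d') (simp_all add: lam_table all_v4 zero_v4_def)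
qed

text \<open>The row of a nonzero \<open>a\<close> moves every symbol and sends \<open>0\<close> to
  \<open>a\<close>, which leaves three candidates for each row. Of the 27 combinations only four
  have columns without repetition.\<close>

lemma latin_square_normal_form:
  fixes L :: "v4 \<Rightarrow> v4 \<Rightarrow> v4"
  assumes "\<And>a. L a 0 = a" "\<And>b. L 0 b = b" "\<And>a. inj (L a)" "\<And>b. inj (\<lambda>a. L a b)"
  shows "\<exists>d. L = lam d"
proof -
  have r: "L a b = L a b' \<longleftrightarrow> b = b'" for a b b'
    using assms(3) by (simp add: inj_eq)
  have c: "L a b = L a' b \<longleftrightarrow> a = a'" for a a' b
    using assms(4) [of b] by (auto dest: injD)
  have z: "L a V0 = a" "L V0 b = b" for a b
    using assms(1,2) by (simp_all add: zero_v4_def)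
  have "distinct [V1, L V1 V1, L V1 V2, L V1 V3]" "L V1 V1 \<noteq> V1" "L V1 V2 \<noteq> V2" "L V1 V3 \<noteq> V3"
    using r [of V1 V0 V1] r [of V1 V0 V2] r [of V1 V0 V3] r [of V1 V1 V2] r [of V1 V1 V3]
      r [of V1 V2 V3] c [of V1 V1 V0] c [of V1 V2 V0] c [of V1 V3 V0]
    by (simp_all add: z)
  then have row1: "L V1 V1 = V0 \<and> L V1 V2 = V3 \<and> L V1 V3 = V2 \<or>
    L V1 V1 = V2 \<and> L V1 V2 = V3 \<and> L V1 V3 = V0 \<or>
    L V1 V1 = V3 \<and> L V1 V2 = V0 \<and> L V1 V3 = V2"
    by (cases "L V1 V1"; cases "L V1 V2"; cases "L V1 V3") simp_all
  have "distinct [V2, L V2 V1, L V2 V2, L V2 V3]" "L V2 V1 \<noteq> V1" "L V2 V2 \<noteq> V2" "L V2 V3 \<noteq> V3"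
    using r [of V2 V0 V1] r [of V2 V0 V2] r [of V2 V0 V3] r [of V2 V1 V2] r [of V2 V1 V3]
      r [of V2 V2 V3] c [of V2 V1 V0] c [of V2 V2 V0] c [of V2 V3 V0]
    by (simp_all add: z)
  then have row2: "L V2 V1 = V0 \<and> L V2 V2 = V3 \<and> L V2 V3 = V1 \<or>
    L V2 V1 = V3 \<and> L V2 V2 = V0 \<and> L V2 V3 = V1 \<or>
    L V2 V1 = V3 \<and> L V2 V2 = V1 \<and> L V2 V3 = V0"
    by (cases "L V2 V1"; cases "L V2 V2"; cases "L V2 V3") simp_all
  have "distinct [V3, L V3 V1, L V3 V2, L V3 V3]" "L V3 V1 \<noteq> V1" "L V3 V2 \<noteq> V2" "L V3 V3 \<noteq> V3"
    using r [of V3 V0 V1] r [of V3 V0 V2] r [of V3 V0 V3] r [of V3 V1 V2] r [of V3 V1 V3]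
      r [of V3 V2 V3] c [of V3 V1 V0] c [of V3 V2 V0] c [of V3 V3 V0]
    by (simp_all add: z)
  then have row3: "L V3 V1 = V0 \<and> L V3 V2 = V1 \<and> L V3 V3 = V2 \<or>
    L V3 V1 = V2 \<and> L V3 V2 = V0 \<and> L V3 V3 = V1 \<or>
    L V3 V1 = V2 \<and> L V3 V2 = V1 \<and> L V3 V3 = V0"
    by (cases "L V3 V1"; cases "L V3 V2"; cases "L V3 V3") simp_all
  have cols: "distinct [L V1 V1, L V2 V1, L V3 V1]" "distinct [L V1 V2, L V2 V2, L V3 V2]"
    by (simp_all add: c)
  define tab where "tab d \<longleftrightarrow> L V1 V1 = lam d V1 V1 \<and> L V1 V2 = lam d V1 V2 \<and> L V1 V3 = lam d V1 V3 \<and>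
    L V2 V1 = lam d V2 V1 \<and> L V2 V2 = lam d V2 V2 \<and> L V2 V3 = lam d V2 V3 \<and>
    L V3 V1 = lam d V3 V1 \<and> L V3 V2 = lam d V3 V2 \<and> L V3 V3 = lam d V3 V3" for d
  from row1 have "tab V0 \<or> tab V1 \<or> tab V2 \<or> tab V3"
    using row2 row3 cols unfolding tab_def
    by (elim disjE conjE) (simp_all add: lam_table zero_v4_def)
  then obtain d where "tab d" by blast
  then have "L a b = lam d a b" for a b
    unfolding tab_def using z by (cases a; cases b) (simp_all add: lam_0 [unfolded zero_v4_def])
  then show ?thesis by (auto simp: fun_eq_iff)
qed


text \<open>Quantification over an explicit list, so that \<open>code_simp\<close> can decide nested
  quantifiers over \<open>v4\<close> by evaluation.\<close>

abbreviation forall_v4 :: "(v4 \<Rightarrow> bool) \<Rightarrow> bool" where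
  "forall_v4 P \<equiv> list_all P [V0, V1, V2, V3]"

lemma forall_v4D: "forall_v4 P \<Longrightarrow> P x"
  by (cases x) simp_all

lemma forall_v4I: "(\<And>x. P x) \<Longrightarrow> forall_v4 P"
  by simp

text \<open>Let \<open>d\<close>, \<open>d1\<close>, \<open>d2\<close> be the types of the three Latin squares through a point of a Latin cube, and
  \<open>e\<close> the type of the square parallel to the first one at height \<open>t\<close>. The predicate below says that
  these two parallel squares have no common value on any vertical line.\<close>

definition slices_disjoint :: "v4 \<Rightarrow> v4 \<Rightarrow> v4 \<Rightarrow> v4 \<Rightarrow> v4 \<Rightarrow> bool" where
  "slices_disjoint d d1 d2 t e \<longleftrightarrow>
     forall_v4 (\<lambda>a. forall_v4 (\<lambda>b. lam d a b \<noteq> t + lam e (tw d1 t a) (tw d2 t b)))"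

text \<open>Three different elements of the Klein group add up to the fourth one. At this height no
  parallel square fits; if the fourth element is \<open>0\<close>, the height \<open>d\<close> has
  this property.\<close>

lemma slices_disjoint_rainbow:
  assumes "slices_disjoint d d1 d2 (if d + d1 + d2 = 0 then d else d + d1 + d2) e"
    and "d \<noteq> d1" "d \<noteq> d2" "d1 \<noteq> d2"
  shows False
proof -
  have "forall_v4 (\<lambda>d. forall_v4 (\<lambda>d1. forall_v4 (\<lambda>d2. forall_v4 (\<lambda>e.
    slices_disjoint d d1 d2 (if d + d1 + d2 = 0 then d else d + d1 + d2) e \<longrightarrow>
    d = d1 \<or> d = d2 \<or> d1 = d2))))"
    by code_simp
  from this [THEN forall_v4D, THEN forall_v4D, THEN forall_v4D, THEN forall_v4D] assms
  show False by blast
qed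

lemma slices_disjoint_toggle:
  assumes "slices_disjoint d c c t e" "c \<noteq> 0" "d \<noteq> 0" "d \<noteq> c" "t \<noteq> 0" "t \<noteq> c"
  shows "e = c + d"
proof -
  have "forall_v4 (\<lambda>d. forall_v4 (\<lambda>c. forall_v4 (\<lambda>t. forall_v4 (\<lambda>e.
    slices_disjoint d c c t e \<longrightarrow> c = 0 \<or> d = 0 \<or> d = c \<or> t = 0 \<or> t = c \<or> e = c + d))))"
    by code_simp
  from this [THEN forall_v4D, THEN forall_v4D, THEN forall_v4D, THEN forall_v4D] assms
  show ?thesis by blast
qed

lemma slices_disjoint_stable:
  assumes "slices_disjoint c c d t e" "c \<noteq> 0" "d \<noteq> 0" "d \<noteq> c" "t \<noteq> 0"
  shows "e = c \<or> e = 0"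
proof -
  have "forall_v4 (\<lambda>c. forall_v4 (\<lambda>d. forall_v4 (\<lambda>t. forall_v4 (\<lambda>e.
    slices_disjoint c c d t e \<longrightarrow> c = 0 \<or> d = 0 \<or> d = c \<or> t = 0 \<or> e = c \<or> e = 0))))"
    by code_simp
  from this [THEN forall_v4D, THEN forall_v4D, THEN forall_v4D, THEN forall_v4D] assms
  show ?thesis by blast
qed

lemma slices_disjoint_persist:
  assumes "slices_disjoint b d1 d2 b e" "b \<noteq> 0" "\<not> off b d1 \<or> \<not> off b d2"
  shows "e = b"
proof -
  have "forall_v4 (\<lambda>b. forall_v4 (\<lambda>d1. forall_v4 (\<lambda>d2. forall_v4 (\<lambda>e.
    slices_disjoint b d1 d2 b e \<longrightarrow> b = 0 \<or> off b d1 \<and> off b d2 \<or> e = b))))"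
    by code_simp
  from this [THEN forall_v4D, THEN forall_v4D, THEN forall_v4D, THEN forall_v4D] assms
  show ?thesis by blast
qed

section \<open>Moves and colours\<close>

locale latin =
  fixes f :: "('i \<Rightarrow> v4) \<Rightarrow> v4" and I :: "'i set"
  assumes bij_line: "i \<in> I \<Longrightarrow> bij (\<lambda>v. f (x(i := v)))"
begin

definition val :: "'i \<Rightarrow> v4 \<Rightarrow> ('i \<Rightarrow> v4) \<Rightarrow> v4" where
  "val i a x = (THE v. f (x(i := v)) = f x + a)"

definition mv :: "'i \<Rightarrow> v4 \<Rightarrow> ('i \<Rightarrow> v4) \<Rightarrow> 'i \<Rightarrow> v4" where
  "mv i a x = x(i := val i a x)"

lemma line_eq_iff: "i \<in> I \<Longrightarrow> f (x(i := v)) = f (x(i := w)) \<longleftrightarrow> v = w"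
  using bij_line [of i x] by (auto simp: bij_def dest: injD)

lemma f_val [simp]:
  assumes "i \<in> I"
  shows "f (x(i := val i a x)) = f x + a"
proof -
  have "\<exists>v. f (x(i := v)) = f x + a"
    using bij_line [OF assms, of x] by (metis bij_pointE)
  then have "\<exists>!v. f (x(i := v)) = f x + a"
    using line_eq_iff [OF assms] by metis
  then show ?thesis
    unfolding val_def by (rule theI')
qed

lemma val_eqI: "i \<in> I \<Longrightarrow> f (x(i := v)) = f x + a \<Longrightarrow> val i a x = v"
  using f_val line_eq_iff by metis

lemma f_mv [simp]: "i \<in> I \<Longrightarrow> f (mv i a x) = f x + a"
  by (simp add: mv_def)

lemma mv_other [simp]: "j \<noteq> i \<Longrightarrow> mv i a x j = x j"
  by (simp add: mv_def)

lemma upd_eq_mv: "i \<in> I \<Longrightarrow> x(i := v) = mv i (f x + f (x(i := v))) x"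
  by (simp add: mv_def val_eqI)

lemma val_mv_same: "i \<in> I \<Longrightarrow> val i a (mv i c x) = val i (c + a) x"
  by (rule val_eqI) (simp_all add: mv_def ac_simps)

lemma mv_mv [simp]: "i \<in> I \<Longrightarrow> mv i a (mv i c x) = mv i (c + a) x"
  by (subst mv_def) (simp add: val_mv_same, simp add: mv_def)

lemma mv_0 [simp]: "i \<in> I \<Longrightarrow> mv i 0 x = x"
  using upd_eq_mv [of i x "x i"] by simp

lemma val_inj: "i \<in> I \<Longrightarrow> val i a x = val i b x \<longleftrightarrow> a = b"
  by (metis f_val add_left_cancel)

lemma val_surj: "i \<in> I \<Longrightarrow> \<exists>a. v = val i a x"
  by (metis fun_upd_same mv_def upd_eq_mv)

section \<open>Colours of squares and their behaviour under moves\<close>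

definition col :: "'i \<Rightarrow> 'i \<Rightarrow> ('i \<Rightarrow> v4) \<Rightarrow> v4" where
  "col i j x = (THE d. \<forall>a b. f (x(i := val i a x, j := val j b x)) = f x + lam d a b)"

lemma f_plane:
  assumes "i \<in> I" "j \<in> I" "i \<noteq> j"
  shows "f (x(i := val i a x, j := val j b x)) = f x + lam (col i j x) a b"
proof -
  define L where "L a b = f x + f (x(i := val i a x, j := val j b x))" for a b
  have val0: "val k 0 x = x k" if "k \<in> I" for k
    using that by (intro val_eqI) simp_all
  have tw: "x(i := val i a x, j := val j b x) = x(j := val j b x, i := val i a x)" for a b
    using assms(3) by (simp add: fun_upd_twist)
  have "\<exists>d. L = lam d"
  proof (rule latin_square_normal_form)
    have "x(i := v, j := x j) = x(i := v)" for v
      using assms by (auto simp: fun_eq_iff)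
    then show "L a 0 = a" for a
      using assms by (simp add: L_def val0)
    show "L 0 b = b" for b
      using assms by (simp add: L_def val0)
    show "inj (L a)" for a
      using assms by (auto simp: inj_def L_def line_eq_iff val_inj)
    show "inj (\<lambda>a. L a b)" for b
      using assms by (auto simp: inj_def L_def tw line_eq_iff val_inj)
  qed
  then obtain d where "L = lam d" ..
  then have d: "f (x(i := val i a x, j := val j b x)) = f x + lam d a b" for a b
    by (metis L_def v4_add_self_left)
  have "\<forall>a b. f (x(i := val i a x, j := val j b x)) = f x + lam (col i j x) a b"
    unfolding col_def
  proof (rule theI)
    show "\<forall>a b. f (x(i := val i a x, j := val j b x)) = f x + lam d a b"
      using d by blast
    show "d' = d" if "\<forall>a b. f (x(i := val i a x, j := val j b x)) = f x + lam d' a b" for d'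
    proof (rule lam_inj, intro ext)
      show "lam d' a b = lam d a b" for a b
        using that d by (metis add_left_cancel)
    qed
  qed
  then show ?thesis by blast
qed

lemma col_eqI:
  assumes "i \<in> I" "j \<in> I" "i \<noteq> j"
    and "\<And>a b. f (x(i := val i a x, j := val j b x)) = f x + lam d a b"
  shows "col i j x = d"
proof -
  have "lam (col i j x) a b = lam d a b" for a b
    using f_plane [OF assms(1-3), of x a b] assms(4) [of a b] by simp
  then have "lam (col i j x) = lam d"
    by (intro ext)
  then show ?thesis
    by (rule lam_inj)
qed

lemma col_sym:
  assumes "i \<in> I" "j \<in> I" "i \<noteq> j"
  shows "col i j x = col j i x"
proof (rule col_eqI [OF assms])
  show "f (x(i := val i a x, j := val j b x)) = f x + lam (col j i x) a b" for a b
    using f_plane [of j i x b a] assms by (simp add: fun_upd_twist lam_commute)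
qed

lemma val_mv_tw:
  assumes "i \<in> I" "j \<in> I" "i \<noteq> j"
  shows "val j (tw (col i j x) c b) (mv i c x) = val j b x"
proof (rule val_eqI [OF assms(2)])
  have "f ((mv i c x)(j := val j b x)) = f x + lam (col i j x) c b"
    using f_plane [OF assms, of x c b] by (simp add: mv_def)
  then show "f ((mv i c x)(j := val j b x)) = f (mv i c x) + tw (col i j x) c b"
    using assms by (simp add: tw_def ac_simps)
qed

lemma val_mv:
  assumes "i \<in> I" "j \<in> I" "i \<noteq> j"
  shows "val j b (mv i c x) = val j (tw (col i j x) c b) x"
  using val_mv_tw [OF assms, of x c "tw (col i j x) c b"] by simp

text \<open>Both sides reach the same corner of a square; only the increments have to be translated,
  once for each order of the two moves.\<close>

lemma mv_commute:
  assumes "i \<in> I" "j \<in> I" "i \<noteq> j" "d = col i j x"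
  shows "mv j b (mv i c x) = mv i (tw d (tw d c b) c) (mv j (tw d c b) x)"
proof -
  have "mv j b (mv i c x) = x(i := val i c x, j := val j (tw d c b) x)"
    using assms by (simp add: mv_def [of j] val_mv) (simp add: mv_def)
  also have "\<dots> = mv i (tw d (tw d c b) c) (mv j (tw d c b) x)"
    using assms col_sym [OF assms(1-3), of x]
    by (simp add: mv_def [of i] val_mv fun_upd_twist) (simp add: mv_def fun_upd_twist)
  finally show ?thesis .
qed

lemma col_mv_left:
  assumes "i \<in> I" "j \<in> I" "i \<noteq> j"
  shows "col i j (mv i c x) = col i j x"
proof (rule col_eqI [OF assms])
  fix a b
  have "f ((mv i c x)(i := val i a (mv i c x), j := val j b (mv i c x)))
      = f (x(i := val i (c + a) x, j := val j (tw (col i j x) c b) x))"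
    using assms by (simp add: val_mv_same val_mv) (simp add: mv_def)
  also have "\<dots> = f x + lam (col i j x) (a + c) (tw (col i j x) c b)"
    using f_plane [OF assms] by (simp add: add.commute)
  also have "\<dots> = f (mv i c x) + lam (col i j x) a b"
    using assms by (simp add: lam_shift ac_simps)
  finally show "f ((mv i c x)(i := val i a (mv i c x), j := val j b (mv i c x)))
      = f (mv i c x) + lam (col i j x) a b" .
qed

lemma col_upd [simp]:
  assumes "i \<in> I" "j \<in> I" "i \<noteq> j"
  shows "col i j (x(i := v)) = col i j x" "col i j (x(j := v)) = col i j x"
proof -
  show "col i j (x(i := v)) = col i j x"
    using assms by (subst upd_eq_mv) (simp_all add: col_mv_left)
  have "col j i (x(j := v)) = col j i x"
    using assms by (subst upd_eq_mv) (simp_all add: col_mv_left)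
  then show "col i j (x(j := v)) = col i j x"
    using assms by (simp add: col_sym)
qed

lemma col_mv [simp]:
  assumes "i \<in> I" "j \<in> I" "i \<noteq> j"
  shows "col i j (mv i c x) = col i j x" "col i j (mv j c x) = col i j x"
  using assms by (simp_all add: mv_def)

text \<open>A common value would occur at the heights \<open>0\<close> and \<open>t\<close> of one
  line in direction \<open>k\<close>, on which \<open>f\<close> is injective. The walls of the cube
  supply the relabellings of the upper square.\<close>

lemma slices_disjoint_col:
  assumes ijk: "i \<in> I" "j \<in> I" "k \<in> I" "i \<noteq> j" "i \<noteq> k" "j \<noteq> k" and "t \<noteq> 0"
  shows "slices_disjoint (col i j x) (col i k x) (col j k x) t (col i j (mv k t x))"
  unfolding slices_disjoint_def
proof (intro forall_v4I notI)
  fix a b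
  assume *: "lam (col i j x) a b
    = t + lam (col i j (mv k t x)) (tw (col i k x) t a) (tw (col j k x) t b)"
  let ?y = "mv k t x" and ?w = "x(i := val i a x, j := val j b x)"
  have "f (?w(k := val k t x)) = f (?y(i := val i a x, j := val j b x))"
    using ijk by (simp add: mv_def fun_upd_twist)
  also have "\<dots> = f (?y(i := val i (tw (col i k x) t a) ?y, j := val j (tw (col j k x) t b) ?y))"
    using ijk col_sym [of i k x] col_sym [of j k x] by (simp add: val_mv)
  also have "\<dots> = f x + t + lam (col i j ?y) (tw (col i k x) t a) (tw (col j k x) t b)"
    using ijk by (simp add: f_plane)
  also have "\<dots> = f x + lam (col i j x) a b"
    by (simp add: * ac_simps)
  also have "\<dots> = f (?w(k := x k))"
    using ijk by (simp add: f_plane fun_upd_twist)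
  finally have "val k t x = x k"
    using ijk by (simp add: line_eq_iff)
  then have "val k t x = val k 0 x"
    using ijk mv_0 [of k x] by (metis fun_upd_same mv_def)
  then show False
    using ijk \<open>t \<noteq> 0\<close> by (simp add: val_inj)
qed

lemma col_not_rainbow:
  assumes "i \<in> I" "j \<in> I" "k \<in> I" "i \<noteq> j" "i \<noteq> k" "j \<noteq> k"
  shows "col i j x = col i k x \<or> col i j x = col j k x \<or> col i k x = col j k x"
proof (rule ccontr)
  let ?d = "col i j x" and ?d1 = "col i k x" and ?d2 = "col j k x"
  assume *: "\<not> ?thesis"
  let ?t = "if ?d + ?d1 + ?d2 = 0 then ?d else ?d + ?d1 + ?d2"
  have "?t \<noteq> 0"
    using * by (auto split: if_splits)
  then show False
    using slices_disjoint_rainbow [OF slices_disjoint_col [OF assms, of ?t x]] * by auto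
qed

lemma col_mv_toggle:
  assumes "i \<in> I" "j \<in> I" "k \<in> I" "i \<noteq> j" "i \<noteq> k" "j \<noteq> k"
    and "col i k x = c" "col j k x = c" "c \<noteq> 0" "off c (col i j x)" "off c t"
  shows "col i j (mv k t x) = c + col i j x"
  using slices_disjoint_col [OF assms(1-6), of t x] slices_disjoint_toggle assms(7-)
  by (auto simp: off_def)

lemma col_mv_stable:
  assumes "i \<in> I" "j \<in> I" "k \<in> I" "i \<noteq> j" "i \<noteq> k" "j \<noteq> k"
    and "col i j x = c" "col i k x = c" "c \<noteq> 0" "off c (col j k x)"
  shows "col i j (mv k t x) = c"
proof (cases "t = 0")
  case False
  have "col i j (mv k t x) = c \<or> col i j (mv k t x) = 0"
    using slices_disjoint_col [OF assms(1-6) False, of x] slices_disjoint_stable assms(7-) False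
    by (auto simp: off_def)
  \<comment> \<open>Squares containing the direction \<open>k\<close> keep their colours, so the
    remaining value \<open>0\<close> would complete a rainbow triangle at the new point.\<close>
  moreover have "col i k (mv k t x) = c" "col j k (mv k t x) = col j k x"
    using assms by simp_all
  ultimately show ?thesis
    using col_not_rainbow [OF assms(1-6), of "mv k t x"] assms(9,10) by (auto simp: off_def)
qed (use assms in simp)

lemma col_mv_persist:
  assumes "i \<in> I" "j \<in> I" "k \<in> I" "i \<noteq> j"
    and "col i j x = b" "b \<noteq> 0" "i \<noteq> k \<Longrightarrow> j \<noteq> k \<Longrightarrow> \<not> off b (col i k x) \<or> \<not> off b (col j k x)"
  shows "col i j (mv k b x) = b"
proof (cases "i = k \<or> j = k")
  case False
  then show ?thesis
    using slices_disjoint_col [of i j k b x] slices_disjoint_persist assms by auto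
qed (use assms in auto)

end

section \<open>Edge colourings without rainbow triangles\<close>

text \<open>Connectedness is expressed by cuts, which suits both monotonicity and arguments by
  contradiction. The empty set and singletons count as connected.\<close>

definition conn :: "('i \<Rightarrow> 'i \<Rightarrow> bool) \<Rightarrow> 'i set \<Rightarrow> bool" where
  "conn R Y \<longleftrightarrow> (\<forall>A \<subseteq> Y. A \<noteq> {} \<longrightarrow> A \<noteq> Y \<longrightarrow> (\<exists>i\<in>A. \<exists>j\<in>Y - A. R i j))"

definition component :: "('i \<Rightarrow> 'i \<Rightarrow> bool) \<Rightarrow> 'i set \<Rightarrow> 'i \<Rightarrow> 'i set" where
  "component R Y i = {j. (\<lambda>u v. u \<in> Y \<and> v \<in> Y \<and> R u v)\<^sup>*\<^sup>* i j}"

lemma connE: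
  assumes "conn R Y" "A \<subseteq> Y" "A \<noteq> {}" "A \<noteq> Y"
  obtains i j where "i \<in> A" "j \<in> Y" "j \<notin> A" "R i j"
  using assms unfolding conn_def by blast

lemma not_connE:
  assumes "\<not> conn R Y"
  obtains A where "A \<subseteq> Y" "A \<noteq> {}" "A \<noteq> Y" "\<And>i j. i \<in> A \<Longrightarrow> j \<in> Y \<Longrightarrow> j \<notin> A \<Longrightarrow> \<not> R i j"
  using assms unfolding conn_def by blast

lemma not_connI:
  assumes "A \<subseteq> Y" "A \<noteq> {}" "A \<noteq> Y" "\<And>i j. i \<in> A \<Longrightarrow> j \<in> Y \<Longrightarrow> j \<notin> A \<Longrightarrow> \<not> R i j"
  shows "\<not> conn R Y"
  using assms unfolding conn_def by blast

lemma conn_mono: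
  assumes "conn R Y" "\<And>i j. i \<in> Y \<Longrightarrow> j \<in> Y \<Longrightarrow> R i j \<Longrightarrow> S i j"
  shows "conn S Y"
  using assms unfolding conn_def by (metis DiffD1 in_mono)

lemma component_self [simp]: "i \<in> component R Y i"
  by (simp add: component_def)

lemma component_step: "j \<in> component R Y i \<Longrightarrow> j \<in> Y \<Longrightarrow> k \<in> Y \<Longrightarrow> R j k \<Longrightarrow> k \<in> component R Y i"
  unfolding component_def by (auto intro: rtranclp.rtrancl_into_rtrancl)

lemma component_subset: "i \<in> Y \<Longrightarrow> component R Y i \<subseteq> Y"
proof
  fix j assume "i \<in> Y" "j \<in> component R Y i"
  then have "(\<lambda>u v. u \<in> Y \<and> v \<in> Y \<and> R u v)\<^sup>*\<^sup>* i j"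
    by (simp add: component_def)
  then show "j \<in> Y" by induction (use \<open>i \<in> Y\<close> in auto)
qed

lemma component_induct [consumes 1, case_names base step]:
  assumes "j \<in> component R Y i" "P i"
    and "\<And>u v. u \<in> component R Y i \<Longrightarrow> u \<in> Y \<Longrightarrow> v \<in> Y \<Longrightarrow> R u v \<Longrightarrow> P u \<Longrightarrow> P v"
  shows "P j"
proof -
  have "(\<lambda>u v. u \<in> Y \<and> v \<in> Y \<and> R u v)\<^sup>*\<^sup>* i j"
    using assms(1) by (simp add: component_def)
  then show ?thesis
    by (induction) (use assms(2,3) in \<open>auto simp: component_def\<close>)
qed

lemma component_sym:
  assumes "\<And>u v. u \<in> Y \<Longrightarrow> v \<in> Y \<Longrightarrow> R u v \<Longrightarrow> R v u" "j \<in> component R Y i"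
  shows "i \<in> component R Y j"
proof -
  have "symp (\<lambda>u v. u \<in> Y \<and> v \<in> Y \<and> R u v)"
    using assms(1) by (auto intro: sympI)
  then have "symp (\<lambda>u v. u \<in> Y \<and> v \<in> Y \<and> R u v)\<^sup>*\<^sup>*"
    by (rule symp_rtranclp)
  then show ?thesis
    using assms(2) by (auto simp: component_def dest: sympD)
qed

lemma component_trans: "j \<in> component R Y i \<Longrightarrow> k \<in> component R Y j \<Longrightarrow> k \<in> component R Y i"
  by (auto simp: component_def)

lemma conn_component:
  assumes sym: "\<And>u v. u \<in> Y \<Longrightarrow> v \<in> Y \<Longrightarrow> R u v \<Longrightarrow> R v u" and "i \<in> Y"
  shows "conn R (component R Y i)"
proof (rule ccontr)
  assume "\<not> conn R (component R Y i)"
  then obtain A where A: "A \<subseteq> component R Y i" "A \<noteq> {}" "A \<noteq> component R Y i"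
      "\<And>u v. u \<in> A \<Longrightarrow> v \<in> component R Y i \<Longrightarrow> v \<notin> A \<Longrightarrow> \<not> R u v"
    by (rule not_connE) blast
  have sub: "component R Y i \<subseteq> Y"
    using \<open>i \<in> Y\<close> by (rule component_subset)
  have "j \<in> A \<longleftrightarrow> i \<in> A" if "j \<in> component R Y i" for j
    using that
  proof (induction rule: component_induct)
    case (step u v)
    have "v \<in> component R Y i"
      using step by (blast intro: component_step)
    then show ?case
      using step A sym by blast
  qed simp
  then show False
    using A(1-3) by blast
qed

lemma component_neq:
  assumes "\<And>u v. u \<in> Y \<Longrightarrow> v \<in> Y \<Longrightarrow> R u v \<Longrightarrow> R v u" "\<not> conn R Y" "i \<in> Y"
  shows "component R Y i \<noteq> Y"
  using conn_component [of Y R i] assms by auto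

lemma conn_subset_component:
  assumes "conn R W" "W \<subseteq> Y" "i \<in> W"
  shows "W \<subseteq> component R Y i"
proof (rule ccontr)
  assume "\<not> W \<subseteq> component R Y i"
  then have "W \<inter> component R Y i \<noteq> W" by blast
  moreover have "i \<in> W \<inter> component R Y i"
    using assms by simp
  ultimately obtain u v where "u \<in> W \<inter> component R Y i" "v \<in> W" "v \<notin> W \<inter> component R Y i" "R u v"
    using connE [OF assms(1), of "W \<inter> component R Y i"] by blast
  then show False
    using assms(2) component_step [of u R Y i v] by blast
qed

lemma conn_insert:
  assumes "conn R Z" "z \<in> Z" "R z v" "R v z" "v \<notin> Z"
  shows "conn R (insert v Z)"
  unfolding conn_def
proof (intro allI impI)
  fix A assume A: "A \<subseteq> insert v Z" "A \<noteq> {}" "A \<noteq> insert v Z"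
  show "\<exists>i\<in>A. \<exists>j\<in>insert v Z - A. R i j"
  proof (cases "A \<inter> Z = {} \<or> A \<inter> Z = Z")
    case True
    then have "A = {v} \<or> A = Z"
      using A by blast
    then show ?thesis
      using assms by auto
  next
    case False
    then obtain i j where "i \<in> A \<inter> Z" "j \<in> Z" "j \<notin> A \<inter> Z" "R i j"
      using connE [OF assms(1), of "A \<inter> Z"] by blast
    then show ?thesis by blast
  qed
qed

lemma conn_pair: "R i j \<Longrightarrow> R j i \<Longrightarrow> conn R {i, j}"
proof -
  assume "R i j" "R j i"
  moreover have "conn R {j}"
    by (auto simp: conn_def)
  ultimately show ?thesis
    using conn_insert [of R "{j}" j i] by (cases "i = j") auto
qed

text \<open>A largest connected proper subset misses just one vertex: an edge leaving it allows one
  more vertex to be added, after which the set can no longer be proper.\<close>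

lemma conn_remove_vertex:
  assumes "finite Y" "2 \<le> card Y" "conn R Y"
    and sym: "\<And>u v. u \<in> Y \<Longrightarrow> v \<in> Y \<Longrightarrow> R u v \<Longrightarrow> R v u"
  shows "\<exists>k\<in>Y. conn R (Y - {k})"
proof -
  define P where "P Z \<longleftrightarrow> Z \<subset> Y \<and> Z \<noteq> {} \<and> conn R Z" for Z
  obtain y where y: "y \<in> Y"
    using assms by fastforce
  have "P {y}"
    using y assms(2) by (auto simp: P_def conn_def)
  moreover have "\<forall>Z. P Z \<longrightarrow> card Z < card Y"
    using assms(1) by (auto simp: P_def intro: psubset_card_mono)
  ultimately have "\<exists>Z. P Z \<and> (\<forall>Z'. P Z' \<longrightarrow> card Z' \<le> card Z)"
    by (rule ex_has_greatest_nat)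
  then obtain Z where "P Z" and max: "\<And>Z'. P Z' \<Longrightarrow> card Z' \<le> card Z"
    by blast
  then have Z: "Z \<subset> Y" "Z \<noteq> {}" "conn R Z"
    by (simp_all add: P_def)
  obtain u v where uv: "u \<in> Z" "v \<in> Y" "v \<notin> Z" "R u v"
    using connE [OF assms(3), of Z] Z by blast
  then have "conn R (insert v Z)"
    using Z sym by (intro conn_insert [of R Z u v]) auto
  moreover have "card (insert v Z) > card Z"
    using Z(1) uv assms(1) by (metis card_insert_disjoint finite_subset lessI psubsetE)
  ultimately have "\<not> insert v Z \<subset> Y"
    using max [of "insert v Z"] by (auto simp: P_def)
  then have "Y - {v} = Z"
    using Z uv by blast
  then show ?thesis
    using Z uv by blast
qed

section \<open>Components in colourings without rainbow triangles\<close>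

definition ed :: "('i \<Rightarrow> 'i \<Rightarrow> v4) \<Rightarrow> v4 \<Rightarrow> 'i \<Rightarrow> 'i \<Rightarrow> bool" where
  "ed c b i j \<longleftrightarrow> i \<noteq> j \<and> off b (c i j)"

text \<open>Here \<open>0\<close> counts as a colour of its own, not as the absence of an edge.\<close>

locale gallai =
  fixes c :: "'i \<Rightarrow> 'i \<Rightarrow> v4" and Y :: "'i set"
  assumes c_sym: "i \<in> Y \<Longrightarrow> j \<in> Y \<Longrightarrow> i \<noteq> j \<Longrightarrow> c i j = c j i"
    and no_rainbow: "i \<in> Y \<Longrightarrow> j \<in> Y \<Longrightarrow> k \<in> Y \<Longrightarrow> i \<noteq> j \<Longrightarrow> i \<noteq> k \<Longrightarrow> j \<noteq> k \<Longrightarrow>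
      c i j = c i k \<or> c i j = c j k \<or> c i k = c j k"
begin

lemma ed_sym: "i \<in> Y \<Longrightarrow> j \<in> Y \<Longrightarrow> ed c b i j \<Longrightarrow> ed c b j i"
  using c_sym by (auto simp: ed_def)

lemma component_ed_sym: "q \<in> component (ed c b) Y p \<Longrightarrow> p \<in> component (ed c b) Y q"
  by (rule component_sym [OF ed_sym])

text \<open>Colours from a component to an outside vertex \<open>w\<close> lie in
  \<open>{0, b}\<close>. Along an edge \<open>s\<close>, \<open>t\<close> of label \<open>b\<close>,
  changing from \<open>b\<close> to \<open>0\<close> would make the triangle \<open>s\<close>,
  \<open>t\<close>, \<open>w\<close> rainbow.\<close>

lemma uniform:
  assumes "b \<noteq> 0" "q \<in> component (ed c b) Y u" "u \<in> Y" "w \<in> Y" "w \<notin> component (ed c b) Y u" "c u w = b"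
  shows "c q w = b"
  using assms(2)
proof (induction rule: component_induct)
  case (step s t)
  have t: "t \<in> component (ed c b) Y u"
    using step by (blast intro: component_step)
  have "s \<noteq> w" "t \<noteq> w"
    using step t assms(5) by auto
  moreover have "\<not> off b (c t w)"
    using component_step [OF t \<open>t \<in> Y\<close> assms(4), of ] assms(5) \<open>t \<noteq> w\<close> by (auto simp: ed_def)
  moreover have "s \<noteq> t" "off b (c s t)"
    using step by (simp_all add: ed_def)
  ultimately show ?case
    using no_rainbow [of s t w] step assms by (auto simp: off_def)
qed (use assms in simp)

text \<open>\<open>ed c 0\<close> joins all pairs of nonzero colour, so such a pair leaves the
  component. Having no label-\<open>b\<close> edge it has colour \<open>b\<close>, and
  \<open>uniform\<close> spreads this colour over the component.\<close>

lemma cross_witness: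
  assumes "conn (ed c 0) Y" "\<not> conn (ed c b) Y" "b \<noteq> 0" "r \<in> Y"
  shows "\<exists>w\<in>Y. w \<notin> component (ed c b) Y r \<and> (\<forall>q\<in>component (ed c b) Y r. c q w = b)"
proof -
  have "component (ed c b) Y r \<noteq> Y"
    using assms by (intro component_neq [OF ed_sym])
  moreover have "component (ed c b) Y r \<subseteq> Y" "component (ed c b) Y r \<noteq> {}"
    using component_subset [OF assms(4)] component_self by fast+
  ultimately obtain u w where uw: "u \<in> component (ed c b) Y r" "w \<in> Y" "w \<notin> component (ed c b) Y r" "ed c 0 u w"
    using connE [OF assms(1), of "component (ed c b) Y r"] by metis
  have "u \<in> Y"
    using uw(1) component_subset [OF assms(4)] by blast
  have "\<not> ed c b u w"
    using component_step [OF uw(1) \<open>u \<in> Y\<close> uw(2)] uw(3) by blast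
  then have "c u w = b"
    using uw(4) by (auto simp: ed_def off_def)
  have ru: "r \<in> component (ed c b) Y u"
    using uw(1) by (rule component_ed_sym)
  have "c q w = b" if "q \<in> component (ed c b) Y r" for q
  proof (rule uniform)
    show "q \<in> component (ed c b) Y u"
      using that ru component_trans by fast
    show "w \<notin> component (ed c b) Y u"
      using uw component_trans by fast
  qed fact+
  then show ?thesis
    using uw by blast
qed

text \<open>If the pair \<open>u\<close>, \<open>v\<close> crossing the cut lies in one component, a
  witness \<open>w\<close> outside sees both in colour \<open>b\<close>. Whichever side
  \<open>w\<close> is on, one of the two lies on the other.\<close>

lemma conn_cross:
  assumes "conn (ed c 0) Y" "\<not> conn (ed c b) Y" "b \<noteq> 0"
  shows "conn (\<lambda>u v. u \<noteq> v \<and> c u v = b \<and> v \<notin> component (ed c b) Y u) Y"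
  unfolding conn_def
proof (intro allI impI)
  fix A assume A: "A \<subseteq> Y" "A \<noteq> {}" "A \<noteq> Y"
  then obtain u v where uv: "u \<in> A" "v \<in> Y" "v \<notin> A" "ed c 0 u v"
    using connE [OF assms(1)] by metis
  show "\<exists>u\<in>A. \<exists>v\<in>Y - A. u \<noteq> v \<and> c u v = b \<and> v \<notin> component (ed c b) Y u"
  proof (cases "v \<in> component (ed c b) Y u")
    case False
    have "\<not> ed c b u v"
      using component_step [of u "ed c b" Y u v] False uv A by auto
    then have "c u v = b"
      using uv by (auto simp: ed_def off_def)
    then show ?thesis
      using uv False by (auto simp: ed_def)
  next
    case True
    have "u \<in> Y"
      using uv A by blast
    then obtain w where w: "w \<in> Y" "w \<notin> component (ed c b) Y u" "\<forall>q\<in>component (ed c b) Y u. c q w = b"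
      using cross_witness [OF assms] by blast
    have uv': "u \<in> component (ed c b) Y v"
      using True by (rule component_ed_sym)
    show ?thesis
    proof (cases "w \<in> A")
      case True
      have "v \<notin> component (ed c b) Y w"
      proof
        assume "v \<in> component (ed c b) Y w"
        then have "w \<in> component (ed c b) Y v"
          by (rule component_ed_sym)
        then show False
          using \<open>v \<in> component (ed c b) Y u\<close> w component_trans by fast
      qed
      moreover have "c w v = b" "w \<noteq> v"
        using w \<open>v \<in> component (ed c b) Y u\<close> c_sym [of w v] uv True by auto
      ultimately show ?thesis
        using True uv by blast
    next
      case False
      have "c u w = b" "u \<noteq> w"
        using w by auto
      then show ?thesis
        using uv w False by blast
    qed
  qed
qed

end

lemma gallai_subset: "gallai c Y \<Longrightarrow> Z \<subseteq> Y \<Longrightarrow> gallai c Z"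
  unfolding gallai_def by (simp add: subset_iff)

text \<open>If every nonzero label were connected, \<open>k\<close> would see only \<open>a\<close>
  and one further colour \<open>e\<close>, and both would occur within one component of
  \<open>Z\<close>. This produces the forbidden four vertices, with the path \<open>k\<close>,
  \<open>u\<close>, \<open>w\<close>, \<open>v\<close> in colour \<open>a\<close> and the path
  \<open>u\<close>, \<open>v\<close>, \<open>k\<close>, \<open>w\<close> in colour
  \<open>e\<close>.\<close>

lemma gallai_insert_vertex:
  assumes "gallai c (insert k Z)" "k \<notin> Z" "a \<noteq> 0"
    and conn0: "conn (ed c 0) Z" and nconn: "\<not> conn (ed c a) Z"
    and pentagon: "\<And>u v w e. u \<in> Z \<Longrightarrow> v \<in> Z \<Longrightarrow> w \<in> Z \<Longrightarrow> u \<noteq> v \<Longrightarrow> u \<noteq> w \<Longrightarrow> v \<noteq> w \<Longrightarrow> off a e \<Longrightarrow>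
      c k u = a \<Longrightarrow> c u w = a \<Longrightarrow> c v w = a \<Longrightarrow> c k v = e \<Longrightarrow> c u v = e \<Longrightarrow> c k w = e \<Longrightarrow> False"
  shows "\<exists>b. b \<noteq> 0 \<and> \<not> conn (ed c b) (insert k Z)"
proof (rule ccontr)
  assume none: "\<not> ?thesis"
  interpret G: gallai c "insert k Z" by fact
  interpret Z: gallai c Z by (rule gallai_subset [OF assms(1)]) blast
  let ?cl = "component (ed c a) Z"
  have sub: "?cl p \<subseteq> Z" if "p \<in> Z" for p
    using that by (rule component_subset)
  have symE: "q \<in> ?cl p \<Longrightarrow> p \<in> ?cl q" for p q
    by (rule Z.component_ed_sym)
  have kp: "k \<noteq> p" if "p \<in> Z" for p
    using that \<open>k \<notin> Z\<close> by blast
  \<comment> \<open>The components of \<open>Z\<close> for label \<open>a\<close> can be joined to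
    the rest only through \<open>k\<close>.\<close>
  have att: "\<exists>q\<in>?cl p. off a (c k q)" if "p \<in> Z" for p
  proof -
    have "conn (ed c a) (insert k Z)"
      using none \<open>a \<noteq> 0\<close> by blast
    moreover have "?cl p \<subseteq> insert k Z" "?cl p \<noteq> {}" "?cl p \<noteq> insert k Z"
      using sub [OF that] \<open>k \<notin> Z\<close> component_self [of p "ed c a" Z] by blast+
    ultimately obtain u v where uv: "u \<in> ?cl p" "v \<in> insert k Z" "v \<notin> ?cl p" "ed c a u v"
      by (rule connE)
    have "v = k"
      using uv component_step [OF uv(1), of v] sub [OF that] by blast
    moreover have "u \<in> Z"
      using uv sub [OF that] by blast
    ultimately have "off a (c k u)"
      using uv G.c_sym [of u k] by (auto simp: ed_def)
    then show ?thesis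
      using uv by blast
  qed
  have wit: "\<exists>w\<in>Z. (\<forall>q\<in>?cl p. c q w = a \<and> q \<noteq> w) \<and> off a (c k w)" if "p \<in> Z" for p
  proof -
    obtain w where w: "w \<in> Z" "w \<notin> ?cl p" "\<forall>q\<in>?cl p. c q w = a"
      using Z.cross_witness [OF conn0 nconn \<open>a \<noteq> 0\<close> \<open>p \<in> Z\<close>] by blast
    \<comment> \<open>By \<open>uniform\<close> a witness may be exchanged for any vertex of its own
      component, and \<open>att\<close> offers one that \<open>k\<close> sees outside
      \<open>{0, a}\<close>.\<close>
    obtain w' where w': "w' \<in> ?cl w" "off a (c k w')"
      using att [OF w(1)] by blast
    have "w' \<in> Z"
      using w' sub [OF w(1)] by blast
    have "c q w' = a \<and> q \<noteq> w'" if q: "q \<in> ?cl p" for q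
    proof -
      have "q \<in> Z"
        using q sub [OF \<open>p \<in> Z\<close>] by blast
      have nq: "q \<notin> ?cl w"
        using q w(2) symE component_trans by fast
      have "q \<noteq> w"
        using q w by blast
      then have "c w q = a"
        using w q Z.c_sym [of w q] \<open>q \<in> Z\<close> by auto
      then have "c w' q = a"
        using Z.uniform [OF \<open>a \<noteq> 0\<close> w'(1) w(1) \<open>q \<in> Z\<close> nq] by blast
      moreover have "q \<noteq> w'"
        using nq w' by blast
      ultimately show ?thesis
        using Z.c_sym [of w' q] \<open>q \<in> Z\<close> \<open>w' \<in> Z\<close> by auto
    qed
    then show ?thesis
      using w' \<open>w' \<in> Z\<close> by blast
  qed
  have pair: "c k p = a \<or> c k p = c k q" if "p \<in> Z" "q \<in> Z" "c p q = a" "p \<noteq> q" "off a (c k q)" for p q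
    using G.no_rainbow [of k p q] that kp by (auto simp: off_def)
  have "Z \<noteq> {}"
    using nconn by (auto simp: conn_def)
  then obtain p0 where "p0 \<in> Z" by blast
  then obtain w0 where w0: "w0 \<in> Z" "off a (c k w0)"
    using wit by blast
  define e where "e = c k w0"
  have cls: "c k q = e" if "p \<in> Z" "q \<in> ?cl p" "off a (c k q)" "q' \<in> ?cl p" "c k q' = e" for p q q'
  proof -
    obtain w where w: "w \<in> Z" "\<forall>q\<in>?cl p. c q w = a \<and> q \<noteq> w" "off a (c k w)"
      using wit [OF \<open>p \<in> Z\<close>] by blast
    have "q \<in> Z" "q' \<in> Z"
      using that sub [OF \<open>p \<in> Z\<close>] by blast+
    then have "c k q = c k w" "c k q' = c k w"
      using pair [of q w] pair [of q' w] w that w0(2) by (auto simp: e_def off_def)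
    then show ?thesis
      using that by simp
  qed
  have all_e: "c k q = e" if "q \<in> Z" "off a (c k q)" for q
  proof -
    \<comment> \<open>The colour \<open>e\<close> spreads from component to component along the
      pairs of \<open>conn_cross\<close>, so every component has a vertex that \<open>k\<close> sees
      in colour \<open>e\<close>.\<close>
    define A where "A = {p \<in> Z. \<exists>q\<in>?cl p. c k q = e}"
    have "A = Z"
    proof (rule ccontr)
      assume "A \<noteq> Z"
      moreover have "w0 \<in> A"
        using w0 by (auto simp: A_def e_def intro: bexI [of _ w0])
      moreover have "A \<subseteq> Z"
        by (auto simp: A_def)
      ultimately obtain u v where "u \<in> A" "v \<in> Z" "v \<notin> A" "u \<noteq> v \<and> c u v = a \<and> v \<notin> ?cl u"
        using connE [OF Z.conn_cross [OF conn0 nconn \<open>a \<noteq> 0\<close>], of A] by (metis empty_iff)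
      then have uv: "u \<in> A" "v \<in> Z" "v \<notin> A" "c u v = a" "v \<notin> ?cl u" "u \<in> Z"
        by (auto simp: A_def)
      then obtain u' where u': "u' \<in> ?cl u" "c k u' = e"
        by (auto simp: A_def)
      obtain v' where v': "v' \<in> ?cl v" "off a (c k v')"
        using att [OF uv(2)] by blast
      have Z: "u \<in> Z" "u' \<in> Z" "v' \<in> Z"
        using u'(1) v'(1) sub [OF uv(6)] sub [OF uv(2)] uv(6) by blast+
      have "c u' v = a"
        using Z.uniform [OF \<open>a \<noteq> 0\<close> u'(1) Z(1) uv(2) uv(5) uv(4)] .
      moreover have nu: "u' \<notin> ?cl v"
        using u' uv(5) symE component_trans by fast
      then have "u' \<noteq> v"
        by auto
      ultimately have "c v u' = a"
        using Z.c_sym [of v u'] Z uv by auto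
      then have "c v' u' = a"
        using Z.uniform [OF \<open>a \<noteq> 0\<close> v'(1) uv(2) Z(2) nu] by blast
      moreover have "v' \<noteq> u'"
        using nu v' by blast
      ultimately have "c k v' = e"
        using pair [of v' u'] Z v' u' w0 by (auto simp: e_def off_def)
      then show False
        using uv v' by (auto simp: A_def)
    qed
    then obtain q' where "q' \<in> ?cl q" "c k q' = e"
      using \<open>q \<in> Z\<close> by (auto simp: A_def)
    then show ?thesis
      using cls [of q q q'] that by simp
  qed
  have ae: "c k q = a \<or> c k q = e" if "q \<in> Z" for q
    using wit [OF that] pair [of q] all_e that component_self by metis
  have e: "off a e" "e \<noteq> 0"
    using w0 by (auto simp: e_def off_def)
  \<comment> \<open>Otherwise \<open>k\<close> sees nothing but \<open>e\<close> and is isolated in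
    the graph of label \<open>e\<close>.\<close>
  have "\<exists>p\<in>Z. c k p = a"
  proof (rule ccontr)
    assume "\<not> ?thesis"
    then have "\<And>q. q \<in> Z \<Longrightarrow> c k q = e"
      using ae by blast
    then have "\<not> conn (ed c e) (insert k Z)"
      using \<open>Z \<noteq> {}\<close> \<open>k \<notin> Z\<close> by (intro not_connI [of "{k}"]) (auto simp: ed_def off_def)
    then show False
      using none e by blast
  qed
  then obtain p where p: "p \<in> Z" "c k p = a" by blast
  define A where "A = {q \<in> ?cl p. c k q = a}"
  obtain p' where p': "p' \<in> ?cl p" "off a (c k p')"
    using att [OF p(1)] by blast
  then have "p' \<notin> A"
    by (auto simp: A_def)
  then have "A \<noteq> ?cl p"
    using p' by blast
  moreover have "conn (ed c a) (?cl p)"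
    by (rule conn_component [OF Z.ed_sym p(1)])
  moreover have "p \<in> A" "A \<subseteq> ?cl p"
    using p by (auto simp: A_def)
  \<comment> \<open>The component of \<open>p\<close> contains vertices that \<open>k\<close> sees
    in colour \<open>a\<close> and others, so an edge of label \<open>a\<close> joins the two
    kinds.\<close>
  ultimately obtain u v where "u \<in> A" "v \<in> ?cl p" "v \<notin> A" "ed c a u v"
    using connE [of "ed c a" "?cl p" A] by (metis empty_iff)
  then have uv: "u \<in> ?cl p" "c k u = a" "v \<in> ?cl p" "c k v \<noteq> a" "ed c a u v"
    by (auto simp: A_def)
  obtain w where w: "w \<in> Z" "\<forall>q\<in>?cl p. c q w = a \<and> q \<noteq> w" "off a (c k w)"
    using wit [OF p(1)] by blast
  have Z: "u \<in> Z" "v \<in> Z"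
    using uv sub [OF p(1)] by blast+
  have "c k v = e"
    using ae [OF Z(2)] uv by blast
  moreover have "c u v = e"
    using G.no_rainbow [of k u v] Z uv \<open>c k v = e\<close> e kp by (auto simp: ed_def off_def)
  moreover have "c k w = e"
    using all_e w by blast
  ultimately show False
    using pentagon [of u v w e] Z w uv e by (auto simp: ed_def)
qed

section \<open>Level sets and splittings\<close>

context latin
begin

abbreviation edge :: "v4 \<Rightarrow> ('i \<Rightarrow> v4) \<Rightarrow> 'i \<Rightarrow> 'i \<Rightarrow> bool" where
  "edge b x \<equiv> ed (\<lambda>i j. col i j x) b"

definition face :: "'i set \<Rightarrow> ('i \<Rightarrow> v4) \<Rightarrow> ('i \<Rightarrow> v4) set" where
  "face E z = {x. \<forall>i. i \<notin> E \<longrightarrow> x i = z i}"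

definition gedge :: "v4 \<Rightarrow> 'i set \<Rightarrow> ('i \<Rightarrow> v4) \<Rightarrow> 'i \<Rightarrow> 'i \<Rightarrow> bool" where
  "gedge b E z i j \<longleftrightarrow> (\<exists>x\<in>face E z. edge b x i j)"

lemma gallai_col: "Y \<subseteq> I \<Longrightarrow> gallai (\<lambda>i j. col i j x) Y"
  by unfold_locales (use col_sym col_not_rainbow in blast)+

lemma edge_sym: "i \<in> I \<Longrightarrow> j \<in> I \<Longrightarrow> edge b x i j \<Longrightarrow> edge b x j i"
  using col_sym by (auto simp: ed_def)

lemma gedge_sym: "i \<in> I \<Longrightarrow> j \<in> I \<Longrightarrow> gedge b E z i j \<Longrightarrow> gedge b E z j i"
  unfolding gedge_def by (blast intro: edge_sym)

lemma edge_upd: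
  assumes "i \<in> I" "j \<in> I"
  shows "edge b (x(i := v)) i j = edge b x i j" "edge b (x(j := v)) i j = edge b x i j"
  using assms by (auto simp: ed_def)

lemma face_self [simp]: "z \<in> face E z"
  by (simp add: face_def)

lemma face_upd [intro]: "x \<in> face E z \<Longrightarrow> i \<in> E \<Longrightarrow> x(i := v) \<in> face E z"
  by (simp add: face_def)

lemma face_mv [intro]: "x \<in> face E z \<Longrightarrow> i \<in> E \<Longrightarrow> mv i a x \<in> face E z"
  by (simp add: mv_def face_upd)

lemma face_slice: "x \<in> face (E - {k}) (z(k := c)) \<longleftrightarrow> x k = c \<and> x \<in> face E z" if "k \<in> E"
  using that by (auto simp: face_def)

lemma face_induct:
  assumes "finite E" "x \<in> face E z" "y \<in> face E z" "P x"
    and step: "\<And>w k v. w \<in> face E z \<Longrightarrow> k \<in> E \<Longrightarrow> P w \<Longrightarrow> P (w(k := v))"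
  shows "P y"
proof -
  have "P (\<lambda>i. if i \<in> A then y i else x i)" if "A \<subseteq> E" for A
    using finite_subset [OF that \<open>finite E\<close>] that
  proof (induction A rule: finite_induct)
    case empty
    then show ?case using assms by simp
  next
    case (insert k A)
    let ?w = "\<lambda>i. if i \<in> A then y i else x i"
    have "P (?w(k := y k))"
      using insert assms by (intro step) (auto simp: face_def)
    moreover have "?w(k := y k) = (\<lambda>i. if i \<in> insert k A then y i else x i)"
      by (auto simp: fun_eq_iff)
    ultimately show ?case by simp
  qed
  moreover have "(\<lambda>i. if i \<in> E then y i else x i) = y"
    using assms(2,3) by (auto simp: face_def fun_eq_iff)
  ultimately show ?thesis
    by (metis subset_refl)
qed

text \<open>An edge is a nonvanishing mixed second difference of \<open>f\<close> modulo
  \<open>{0, b}\<close>: on a square this difference takes only the value \<open>0\<close> and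
  possibly its colour.\<close>

lemma edge_iff_mixed_difference:
  assumes "i \<in> I" "j \<in> I" "i \<noteq> j" "b \<noteq> 0"
  shows "edge b x i j \<longleftrightarrow>
    (\<exists>u v. off b (f x + f (x(i := u)) + f (x(j := v)) + f (x(i := u, j := v))))"
proof -
  let ?d = "col i j x"
  have eq: "f x + f (x(i := val i a x)) + f (x(j := val j a' x)) + f (x(i := val i a x, j := val j a' x))
      = (if ?d \<noteq> 0 \<and> off ?d a \<and> off ?d a' then ?d else 0)" for a a'
    using assms(1-3) by (simp add: f_plane lam_def ac_simps)
  show ?thesis
  proof
    assume "edge b x i j"
    then have "?d \<noteq> 0" "off b ?d"
      by (auto simp: ed_def off_def)
    then show "\<exists>u v. off b (f x + f (x(i := u)) + f (x(j := v)) + f (x(i := u, j := v)))"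
      using eq ex_off [of ?d] by (metis (full_types))
  next
    assume "\<exists>u v. off b (f x + f (x(i := u)) + f (x(j := v)) + f (x(i := u, j := v)))"
    then obtain u v where uv: "off b (f x + f (x(i := u)) + f (x(j := v)) + f (x(i := u, j := v)))"
      by blast
    obtain a a' where "u = val i a x" "v = val j a' x"
      using val_surj assms(1,2) by meson
    then have "off b (if ?d \<noteq> 0 \<and> off ?d a \<and> off ?d a' then ?d else 0)"
      using uv eq by simp
    then show "edge b x i j"
      using assms(3) by (auto simp: ed_def split: if_splits)
  qed
qed

lemma not_edge_additive:
  assumes "i \<in> I" "j \<in> I" "i \<noteq> j" "b \<noteq> 0" "\<not> edge b x i j"
  shows "off b (f (x(i := u, j := v)) + f (x(j := v))) = off b (f (x(i := u)) + f x)"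
  using assms edge_iff_mixed_difference [OF assms(1-4), of x]
  by (auto simp: off_add)

text \<open>Modulo \<open>{0, b}\<close> the increment of \<open>f\<close> in direction
  \<open>i\<close> does not depend on coordinate \<open>l\<close>, for any value at
  \<open>j\<close>. The mixed difference in \<open>i\<close> and \<open>j\<close> is therefore
  unaffected.\<close>

lemma edge_upd_other:
  assumes I: "i \<in> I" "j \<in> I" "l \<in> I" "i \<noteq> j" "i \<noteq> l" "b \<noteq> 0"
    and ne: "\<And>w. \<not> edge b (x(j := w)) i l"
  shows "edge b (x(l := v)) i j \<longleftrightarrow> edge b x i j"
proof (cases "j = l")
  case True
  then show ?thesis using I by (simp add: edge_upd)
next
  case False
  have "off b (f (x(l := v)) + f (x(l := v, i := u)) + f (x(l := v, j := w)) + f (x(l := v, i := u, j := w)))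
      = off b (f x + f (x(i := u)) + f (x(j := w)) + f (x(i := u, j := w)))" for u w
    using not_edge_additive [OF I(1,3,5,6) ne [of "x j"], of u v] not_edge_additive [OF I(1,3,5,6) ne [of w], of u v]
      I(4-6) False
    by (simp add: off_add fun_upd_twist) argo
  then show ?thesis
    using I by (simp add: edge_iff_mixed_difference)
qed

section \<open>Points connected by moves of type \<open>b\<close>\<close>

definition reach :: "v4 \<Rightarrow> 'i set \<Rightarrow> ('i \<Rightarrow> v4) \<Rightarrow> ('i \<Rightarrow> v4) \<Rightarrow> bool" where
  "reach b E = (\<lambda>x y. \<exists>i\<in>E. y = mv i b x)\<^sup>*\<^sup>*"

lemma reach_refl [simp]: "reach b E x x"
  by (simp add: reach_def)

lemma reach_trans [trans]: "reach b E x y \<Longrightarrow> reach b E y w \<Longrightarrow> reach b E x w"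
  by (simp add: reach_def)

lemma reach_mv: "i \<in> E \<Longrightarrow> reach b E x (mv i b x)"
  unfolding reach_def by blast

lemma reach_induct [consumes 1, case_names base step]:
  assumes "reach b E x y" "P x" "\<And>w i. reach b E x w \<Longrightarrow> P w \<Longrightarrow> i \<in> E \<Longrightarrow> P (mv i b w)"
  shows "P y"
  using assms(1) unfolding reach_def
  by (induction) (use assms(2,3) in \<open>auto simp: reach_def\<close>)

lemma reach_sym:
  assumes "E \<subseteq> I" "reach b E x y"
  shows "reach b E y x"
  using assms(2)
proof (induction rule: reach_induct)
  case (step w i)
  then have "reach b E (mv i b w) (mv i b (mv i b w))"
    by (intro reach_mv)
  then have "reach b E (mv i b w) w"
    using step assms(1) by (simp add: subset_iff)
  then show ?case
    using step reach_trans by blast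
qed simp

lemma reach_face: "reach b E x y \<Longrightarrow> x \<in> face E z \<Longrightarrow> y \<in> face E z"
  by (induction rule: reach_induct) auto

text \<open>A flip at \<open>i\<close> is a move \<open>mv i c\<close> with \<open>c\<close> outside \<open>{0, b}\<close>. Up to moves of type \<open>b\<close> it does not
  depend on \<open>c\<close>, flips commute, and flips at adjacent coordinates agree. Hence the classes of
  mutually reachable points form an orbit of an elementary abelian group, which has order 2 when
  the graph of label \<open>b\<close> is connected.\<close>

lemma reach_flips:
  assumes "E \<subseteq> I" "i \<in> E" "off b c" "off b c'" "b \<noteq> 0"
  shows "reach b E (mv i c x) (mv i c' x)"
proof -
  have "c' = c \<or> c' = c + b"
    using assms(3-5) by (cases b; cases c; cases c') (simp_all add: off_def zero_v4_def)
  moreover have "mv i (c + b) x = mv i b (mv i c x)"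
    using assms by (simp add: subset_iff)
  ultimately show ?thesis
    using reach_mv [OF assms(2), of b "mv i c x"] by auto
qed

lemma reach_flip_cong:
  assumes E: "E \<subseteq> I" and "i \<in> E" "off b c" "reach b E x y" "b \<noteq> 0"
  shows "reach b E (mv i c x) (mv i c y)"
  using assms(4)
proof (induction rule: reach_induct)
  case (step w k)
  have "reach b E (mv i c w) (mv i c (mv k b w))"
  proof (cases "k = i")
    case True
    have "mv i c (mv i b w) = mv i b (mv i c w)"
      using assms by (simp add: subset_iff add.commute)
    then show ?thesis
      using True step by (simp add: reach_mv)
  next
    case False
    define d where "d = col k i w"
    \<comment> \<open>A size of flip that commutes exactly with the move \<open>b\<close> in the
      square of colour \<open>d\<close>: \<open>d\<close> itself if it lies outside
      \<open>{0, b}\<close>, and otherwise \<open>c\<close>.\<close>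
    obtain c' where c': "off b c'" "tw d b c' = c'" "tw d c' b = b"
    proof (cases "off b d")
      case True
      then show ?thesis
        using that [of d] by (simp add: tw_def lam_def ac_simps)
    next
      case False
      then show ?thesis
        using that [of c] assms(3) by (auto simp: tw_def lam_def off_def ac_simps)
    qed
    have "mv i c' (mv k b w) = mv k b (mv i c' w)"
      using mv_commute [of k i d w c' b] c' step assms False by (auto simp: d_def)
    then have "reach b E (mv i c' w) (mv i c' (mv k b w))"
      using reach_mv step by simp
    then show ?thesis
      using reach_flips [OF E \<open>i \<in> E\<close>] c' assms(3) \<open>b \<noteq> 0\<close> reach_trans by meson
  qed
  then show ?case
    using step reach_trans by blast
qed simp

lemma reach_flip_commute:
  assumes E: "E \<subseteq> I" and "i \<in> E" "j \<in> E" "off b c" "off b c'" "b \<noteq> 0"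
  shows "reach b E (mv j c' (mv i c x)) (mv i c (mv j c' x))"
proof (cases "i = j")
  case True
  then show ?thesis
    using assms by (simp add: subset_iff add.commute)
next
  case False
  define d where "d = col i j x"
  \<comment> \<open>Sizes for which both translated moves in \<open>mv_commute\<close> are flips
    again.\<close>
  obtain e e' where e: "off b e" "off b e'" "off b (tw d e e')" "off b (tw d (tw d e e') e)"
  proof (cases "off b d")
    case True
    then show ?thesis
      using that [of d d] by (simp add: tw_def lam_def ac_simps)
  next
    case False
    then have "off b (tw d c c')" "off b (tw d (tw d c c') c)"
      using assms(4-6) by (auto simp: tw_def lam_def off_add)
    then show ?thesis
      using that [of c c'] assms by simp
  qed
  have eq: "mv j e' (mv i e x) = mv i (tw d (tw d e e') e) (mv j (tw d e e') x)"
    using mv_commute [of i j d x e' e] assms False by (auto simp: d_def)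
  have "reach b E (mv j c' (mv i c x)) (mv j c' (mv i e x))"
    by (intro reach_flip_cong reach_flips) (use assms e in auto)
  also have "reach b E (mv j c' (mv i e x)) (mv j e' (mv i e x))"
    by (intro reach_flips) (use assms e in auto)
  also note eq
  also have "reach b E (mv i (tw d (tw d e e') e) (mv j (tw d e e') x)) (mv i c (mv j (tw d e e') x))"
    by (intro reach_flips) (use assms e in auto)
  also have "reach b E (mv i c (mv j (tw d e e') x)) (mv i c (mv j c' x))"
    by (intro reach_flip_cong reach_flips) (use assms e in auto)
  finally show ?thesis .
qed

text \<open>If the colour \<open>d\<close> lies outside \<open>{0, b}\<close>, the move
  \<open>b\<close> at \<open>i\<close> followed by the flip \<open>b + d\<close> at \<open>j\<close>
  ends where the move \<open>b\<close> at \<open>j\<close> followed by the flip \<open>b + d\<close>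
  at \<open>i\<close> ends. Up to moves of type \<open>b\<close> the two flips therefore
  agree.\<close>

lemma reach_flip_edge:
  assumes E: "E \<subseteq> I" and "i \<in> E" "j \<in> E" "off b c" "b \<noteq> 0" "edge b x i j"
  shows "reach b E (mv i c x) (mv j c x)"
proof -
  define d where "d = col i j x"
  have d: "off b d" "i \<noteq> j"
    using assms by (auto simp: ed_def d_def)
  have e: "off b (b + d)" "tw d b (b + d) = b" "tw d b b = b + d"
    using d(1) \<open>b \<noteq> 0\<close>
    by (cases b; cases d; simp add: off_def zero_v4_def tw_table)+
  have "mv j (b + d) (mv i b x) = mv i (b + d) (mv j b x)"
    using mv_commute [of i j d x "b + d" b] assms d e by (auto simp: d_def)
  moreover have "reach b E (mv j (b + d) x) (mv j (b + d) (mv i b x))"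
    by (intro reach_flip_cong reach_mv) (use assms e in auto)
  moreover have "reach b E (mv i (b + d) x) (mv i (b + d) (mv j b x))"
    by (intro reach_flip_cong reach_mv) (use assms e in auto)
  moreover have "reach b E (mv i c x) (mv i (b + d) x)" "reach b E (mv j (b + d) x) (mv j c x)"
    by (intro reach_flips; use assms e in auto)+
  ultimately show ?thesis
    using reach_sym [OF E] reach_trans by metis
qed

text \<open>By connectedness all flips agree on the face. Every change of a coordinate is a flip or
  at most a move \<open>b\<close>, and the parity of the number of flips can be read from
  \<open>f x + f y\<close> modulo \<open>{0, b}\<close>.\<close>

theorem reach_level_set:
  assumes E: "E \<subseteq> I" "finite E" and conn: "conn (gedge b E z) E" and "b \<noteq> 0"
    and xy: "x \<in> face E z" "y \<in> face E z" "\<not> off b (f x + f y)"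
  shows "reach b E x y"
proof -
  obtain c where c: "off b c"
    using ex_off by blast
  note S = reach_sym [OF E(1)] and T = reach_trans
    and cong = reach_flip_cong [OF E(1) _ c _ \<open>b \<noteq> 0\<close>]
    and comm = reach_flip_commute [OF E(1) _ _ c c \<open>b \<noteq> 0\<close>]
  have upd: "w(k := v) = mv k (f w + f (w(k := v))) w" if "k \<in> E" for w k v
    using that E upd_eq_mv by blast
  have mvc: "reach b E (mv k a w) (mv k c w)" if "k \<in> E" "off b a" for k a w
    using reach_flips [OF E(1) that c \<open>b \<noteq> 0\<close>] .
  have mvb: "reach b E w (mv k a w)" if "k \<in> E" "\<not> off b a" for k a w
    using that E reach_mv by (auto simp: off_def)
  \<comment> \<open>An edge at the single point \<open>w0\<close> identifies the two flips on the
    whole face, because they respect \<open>reach\<close> and commute with all other flips.\<close>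
  have propagate: "reach b E (mv i c w) (mv j c w)"
    if "i \<in> E" "j \<in> E" "edge b w0 i j" "w0 \<in> face E z" "w \<in> face E z" for i j w0 w
  proof (rule face_induct [OF E(2) that(4,5)])
    show "reach b E (mv i c w0) (mv j c w0)"
      using reach_flip_edge that E c \<open>b \<noteq> 0\<close> by blast
    fix w k v
    assume w: "k \<in> E" "reach b E (mv i c w) (mv j c w)"
    let ?a = "f w + f (w(k := v))"
    show "reach b E (mv i c (w(k := v))) (mv j c (w(k := v)))"
    proof (cases "off b ?a")
      case False
      then have "reach b E w (w(k := v))"
        by (subst upd [OF w(1)]) (rule mvb [OF w(1) False])
      then show ?thesis
        using cong that w S T by meson
    next
      case True
      have "reach b E (w(k := v)) (mv k c w)"
        by (subst upd [OF w(1)]) (rule mvc [OF w(1) True])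
      moreover have "reach b E (mv k c (mv i c w)) (mv k c (mv j c w))"
        using cong w by blast
      ultimately show ?thesis
        using cong comm that w S T by meson
    qed
  qed
  show ?thesis
  proof (cases "E = {}")
    case True
    then have "x = y"
      using xy by (auto simp: face_def)
    then show ?thesis by simp
  next
    case False
    then obtain i0 where i0: "i0 \<in> E" by blast
    define A where "A = {j \<in> E. \<forall>w\<in>face E z. reach b E (mv i0 c w) (mv j c w)}"
    have "A = E"
    proof (rule ccontr)
      assume "A \<noteq> E"
      moreover have "A \<subseteq> E" "i0 \<in> A"
        using i0 by (auto simp: A_def)
      ultimately obtain i j where ij: "i \<in> A" "j \<in> E" "j \<notin> A" "gedge b E z i j"
        using connE [OF conn, of A] by (metis empty_iff)
      then obtain w0 where "edge b w0 i j" "w0 \<in> face E z"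
        by (auto simp: gedge_def)
      then have "reach b E (mv i c w) (mv j c w)" if "w \<in> face E z" for w
        using propagate ij that by (auto simp: A_def)
      then have "j \<in> A"
        using ij T by (fastforce simp: A_def)
      then show False
        using ij by blast
    qed
    then have flips: "reach b E (mv i0 c w) (mv j c w)" if "j \<in> E" "w \<in> face E z" for j w
      using that by (auto simp: A_def)
    \<comment> \<open>Every point is reachable from \<open>x\<close> or from the flipped
      \<open>x\<close>; strengthening the claim to both cases lets the induction over coordinates
      pass.\<close>
    have "if off b (f x + f y) then reach b E (mv i0 c x) y else reach b E x y"
    proof (rule face_induct [OF E(2) xy(1,2), of "\<lambda>y. if off b (f x + f y) then reach b E (mv i0 c x) y else reach b E x y"])
      show "if off b (f x + f x) then reach b E (mv i0 c x) x else reach b E x x"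
        by simp
      fix w k v
      assume w: "w \<in> face E z" "k \<in> E"
        and IH: "if off b (f x + f w) then reach b E (mv i0 c x) w else reach b E x w"
      let ?a = "f w + f (w(k := v))" and ?w = "w(k := v)"
      have "off b (f x + f ?w) = (off b (f x + f w) \<noteq> off b ?a)"
        using \<open>b \<noteq> 0\<close> by (simp add: off_add) argo
      moreover have "reach b E w ?w" if "\<not> off b ?a"
        by (subst upd [OF w(2)]) (rule mvb [OF w(2) that])
      moreover have "reach b E (mv k c w) ?w" if "off b ?a"
        by (subst upd [OF w(2)]) (rule S, rule mvc [OF w(2) that])
      moreover have "reach b E (mv i0 c x) (mv k c w)" if "reach b E x w"
        using flips [OF w(2) xy(1)] cong [OF w(2) that] T by blast
      moreover have "reach b E x (mv k c w)" if "reach b E (mv i0 c x) w"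
      proof -
        have "mv i0 c x \<in> face E z"
          using xy i0 by blast
        then have "reach b E (mv i0 c (mv i0 c x)) (mv k c (mv i0 c x))"
          using flips w by blast
        moreover have "mv i0 c (mv i0 c x) = x"
          using i0 E by (simp add: subset_iff)
        ultimately show ?thesis
          using cong [OF w(2) that] T by metis
      qed
      ultimately show "if off b (f x + f ?w) then reach b E (mv i0 c x) ?w else reach b E x ?w"
        using IH T by (metis (full_types))
    qed
    then show ?thesis
      using xy(3) by simp
  qed
qed

section \<open>Splitting off a component\<close>

lemma gedge_restrict:
  assumes E: "E \<subseteq> I" "finite E" and "b \<noteq> 0" "W \<subseteq> E"
    and sep: "\<And>i j. i \<in> W \<Longrightarrow> j \<in> E - W \<Longrightarrow> \<not> gedge b E z i j"
    and ij: "i \<in> W" "j \<in> W" "gedge b E z i j" and z': "z' \<in> face E z"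
  shows "gedge b W z' i j"
proof -
  obtain x where x: "x \<in> face E z" "edge b x i j"
    using ij by (auto simp: gedge_def)
  define y where "y = (\<lambda>k. if k \<in> W then x k else z' k)"
  have "finite (E - W)" "y \<in> face (E - W) x"
    using E x z' by (auto simp: y_def face_def)
  then have "edge b y i j"
  proof (rule face_induct [of "E - W" x x y "\<lambda>y. edge b y i j", OF _ face_self])
    fix w k v
    assume w: "w \<in> face (E - W) x" "k \<in> E - W" "edge b w i j"
    \<comment> \<open>As \<open>k\<close> lies outside \<open>W\<close>, \<open>i\<close> and
      \<open>k\<close> are nowhere joined on the face, so \<open>edge_upd_other\<close> keeps the
      edge between \<open>i\<close> and \<open>j\<close>.\<close>
    have "w(j := u) \<in> face E z" for u
      using w(1) x(1) ij \<open>W \<subseteq> E\<close> by (auto simp: face_def)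
    then have "\<not> edge b (w(j := u)) i k" for u
      using sep [OF ij(1) w(2)] by (auto simp: gedge_def)
    moreover have "i \<noteq> j"
      using w(3) by (simp add: ed_def)
    ultimately show "edge b (w(k := v)) i j"
      using edge_upd_other [of i j k b w v] w E ij \<open>b \<noteq> 0\<close> \<open>W \<subseteq> E\<close> by blast
  qed (use x in simp)
  moreover have "y \<in> face W z'"
    by (simp add: y_def face_def)
  ultimately show ?thesis
    by (auto simp: gedge_def)
qed

text \<open>Points of equal value that differ only on \<open>W\<close> are linked by moves
  \<open>b\<close> inside \<open>W\<close>. Such moves do not alter the effect of replacing a
  coordinate outside \<open>W\<close>, so these coordinates can be replaced one at a time.\<close>

theorem split_of_component:
  assumes E: "E \<subseteq> I" "finite E" and "b \<noteq> 0" "W \<subseteq> E" and conn: "conn (gedge b E z) W"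
    and sep: "\<And>i j. i \<in> W \<Longrightarrow> j \<in> E - W \<Longrightarrow> \<not> gedge b E z i j"
    and xy: "x \<in> face E z" "y \<in> face E z" "\<And>j. j \<notin> W \<Longrightarrow> x j = y j" "f x = f y"
    and "w \<in> face E z"
  shows "f (\<lambda>j. if j \<in> W then x j else w j) = f (\<lambda>j. if j \<in> W then y j else w j)"
proof -
  let ?u = "\<lambda>A j. if j \<in> A then w j else x j" and ?v = "\<lambda>A j. if j \<in> A then w j else y j"
  have "f (?u A) = f (?v A)" if "A \<subseteq> E - W" for A
    using finite_subset [OF that finite_Diff [OF E(2)]] that
  proof (induction A rule: finite_induct)
    case empty
    then show ?case using xy by simp
  next
    case (insert j A)
    have fc: "?u A \<in> face E z" "?v A \<in> face W (?u A)"
      using insert xy assms by (auto simp: face_def)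
    have jI: "j \<in> I" "j \<in> E - W"
      using insert E by auto
    have inv: "f (t(j := w j)) + f t = f ((?u A)(j := w j)) + f (?u A)" if "reach b W (?u A) t" for t
      using that
    proof (induction rule: reach_induct)
      case (step t i)
      have i: "i \<in> I" "i \<noteq> j"
        using step assms insert E by auto
      have "t \<in> face E z"
        using reach_face [OF step(1) face_self] fc(1) \<open>W \<subseteq> E\<close> by (auto simp: face_def subset_iff)
      then have "\<not> edge b t i j"
        using sep [of i j] step jI by (auto simp: gedge_def)
      then have col: "\<not> off b (col i j t)"
        using i by (simp add: ed_def)
      obtain a where a: "w j = val j a t"
        using val_surj [OF jI(1)] by blast
      have "f ((mv i b t)(j := w j)) = f t + lam (col i j t) b a"
        using f_plane [of i j t b a] i jI a by (simp add: mv_def)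
      \<comment> \<open>For a colour in \<open>{0, b}\<close> the row of \<open>b\<close> has no
        twist.\<close>
      moreover have "lam (col i j t) b a = b + a"
        using col by (auto simp: lam_def off_def)
      moreover have "f (t(j := w j)) = f t + a"
        using a jI by simp
      ultimately have "f ((mv i b t)(j := w j)) + f (mv i b t) = f (t(j := w j)) + f t"
        using i by (simp add: ac_simps)
      from trans [OF this step.IH] show ?case .
    qed simp
    have "reach b W (?u A) (?v A)"
    proof (rule reach_level_set)
      show "conn (gedge b W (?u A)) W"
        by (rule conn_mono [OF conn gedge_restrict [OF E \<open>b \<noteq> 0\<close> \<open>W \<subseteq> E\<close> sep]]) (use fc in auto)
      show "\<not> off b (f (?u A) + f (?v A))"
        using insert by simp
    qed (use assms fc finite_subset in auto)
    then have "f ((?v A)(j := w j)) = f ((?u A)(j := w j))"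
      using inv [of "?v A"] insert by (metis (no_types, lifting) add_right_cancel insert_subset)
    moreover have "?u (insert j A) = (?u A)(j := w j)" "?v (insert j A) = (?v A)(j := w j)"
      by auto
    ultimately show ?case by simp
  qed
  from this [of "E - W"] have "f (?u (E - W)) = f (?v (E - W))" by simp
  moreover have "?u (E - W) = (\<lambda>j. if j \<in> W then x j else w j)"
    "?v (E - W) = (\<lambda>j. if j \<in> W then y j else w j)"
    using assms by (auto simp: face_def fun_eq_iff)
  ultimately show ?thesis by simp
qed

end

section \<open>Existence of a disconnected label\<close>

context latin
begin

text \<open>A largest component \<open>W\<close> among all slices is a union of components of the
  whole face: maximality keeps it from growing in slices of another direction \<open>l\<close>, and
  this excludes edges from \<open>W\<close> to \<open>k\<close> as well.\<close>

lemma disconnected_of_slices: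
  assumes E: "E \<subseteq> I" "finite E" "E \<noteq> {}" and "b \<noteq> 0"
    and slices: "\<And>k c. k \<in> E \<Longrightarrow> \<not> conn (gedge b (E - {k}) (z(k := c))) (E - {k})"
  shows "\<not> conn (gedge b E z) E"
proof -
  define S where "S k c = gedge b (E - {k}) (z(k := c))" for k c
  define P where "P = (\<lambda>(k, c :: v4, w). k \<in> E \<and> w \<in> E - {k})"
  define W' where "W' = (\<lambda>(k, c, w). component (S k c) (E - {k}) w)"
  have Ssym: "S k c j i" if "i \<in> E - {k}" "j \<in> E - {k}" "S k c i j" for i j k c
    using that E gedge_sym unfolding S_def by blast
  have sub: "component (S k c) (E - {k}) w \<subseteq> E - {k}" if "w \<in> E - {k}" for k c w
    using that by (rule component_subset)
  obtain k0 where "k0 \<in> E" using E by blast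
  moreover have "E - {k0} \<noteq> {}"
  proof
    assume "E - {k0} = {}"
    then have "conn (gedge b (E - {k0}) (z(k0 := 0))) (E - {k0})"
      unfolding conn_def by blast
    then show False
      using slices \<open>k0 \<in> E\<close> by blast
  qed
  ultimately obtain w0 where "P (k0, 0, w0)"
    by (auto simp: P_def)
  moreover have "\<forall>t. P t \<longrightarrow> card (W' t) < Suc (card E)"
    using sub E(2) by (auto simp: P_def W'_def less_Suc_eq_le intro!: card_mono)
  ultimately have "\<exists>t. P t \<and> (\<forall>t'. P t' \<longrightarrow> card (W' t') \<le> card (W' t))"
    by (rule ex_has_greatest_nat)
  then obtain k c w where "P (k, c, w)"
    and max: "\<And>k' c' w'. P (k', c', w') \<Longrightarrow> card (W' (k', c', w')) \<le> card (W' (k, c, w))"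
    by auto
  then have k: "k \<in> E" "w \<in> E - {k}"
    by (auto simp: P_def)
  define W where "W = component (S k c) (E - {k}) w"
  have W: "W \<subseteq> E - {k}" "w \<in> W" "W \<noteq> E - {k}"
  proof -
    have "component (S k c) (E - {k}) w \<noteq> E - {k}"
    proof (rule component_neq [OF Ssym])
      show "\<not> conn (S k c) (E - {k})"
        using slices [OF k(1)] by (simp add: S_def)
    qed (use k in auto)
    then show "W \<noteq> E - {k}"
      by (simp add: W_def)
  qed (use sub [OF k(2)] in \<open>auto simp: W_def\<close>)
  have connW: "conn (S k c) W"
    unfolding W_def using Ssym k(2) by (rule conn_component)
  have sep1: "\<not> S k c i j" if "i \<in> W" "j \<in> E - {k}" "j \<notin> W" for i j
    using that component_step [of i "S k c" "E - {k}" w j] W unfolding W_def by blast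
  have face: "x \<in> face (E - {k}) (z(k := c)) \<longleftrightarrow> x k = c \<and> x \<in> face E z" for x
    using k by (intro face_slice)
  obtain l where l: "l \<in> E" "l \<noteq> k" "l \<notin> W"
    using W by blast
  \<comment> \<open>\<open>W\<close> has no edges to \<open>l\<close> in its own slice, so its edges
    survive in the slices of direction \<open>l\<close>; by maximality no further vertex joins
    it.\<close>
  have comp_l: "component (S l d) (E - {l}) w = W" for d
  proof -
    have "conn (S l d) W"
    proof (rule conn_mono [OF connW])
      fix i j assume ij: "i \<in> W" "j \<in> W" "S k c i j"
      then obtain x where x: "x \<in> face (E - {k}) (z(k := c))" "edge b x i j"
        by (auto simp: S_def gedge_def)
      have "x(j := u) \<in> face (E - {k}) (z(k := c))" for u
        using x ij W by blast
      then have "\<not> edge b (x(j := u)) i l" for u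
        using sep1 [OF ij(1)] l by (auto simp: S_def gedge_def)
      moreover have "i \<noteq> j" "i \<noteq> l"
        using x ij l by (auto simp: ed_def)
      ultimately have "edge b (x(l := d)) i j"
        using edge_upd_other [of i j l b x d] x ij l W E \<open>b \<noteq> 0\<close> by blast
      moreover have "x(l := d) \<in> face (E - {l}) (z(l := d))"
        using x l k by (auto simp: face_def)
      ultimately show "S l d i j"
        by (auto simp: S_def gedge_def)
    qed
    moreover have Wl: "W \<subseteq> E - {l}" "w \<in> W"
      using W l by auto
    ultimately have "W \<subseteq> component (S l d) (E - {l}) w"
      by (rule conn_subset_component)
    moreover have "P (l, d, w)"
      using Wl l by (auto simp: P_def)
    then have "card (component (S l d) (E - {l}) w) \<le> card W"
      using max [of l d w] by (simp add: W'_def W_def)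
    moreover have "finite (component (S l d) (E - {l}) w)"
      using sub [of w l d] Wl E finite_subset by (metis finite_Diff subsetD)
    ultimately show ?thesis
      using card_seteq by blast
  qed
  have sep2: "\<not> edge b x i k" if "x \<in> face E z" "i \<in> W" for x i
  proof
    assume "edge b x i k"
    moreover have "x \<in> face (E - {l}) (z(l := x l))"
      using that l by (simp add: face_slice)
    ultimately have "S l (x l) i k"
      by (auto simp: S_def gedge_def)
    moreover have "i \<in> component (S l (x l)) (E - {l}) w"
      using that comp_l by simp
    ultimately have "k \<in> component (S l (x l)) (E - {l}) w"
      using component_step [of i "S l (x l)" "E - {l}" w k] W l k that by blast
    then show False
      using comp_l W by blast
  qed
  show ?thesis
  proof (rule not_connI [of W])
    fix i j assume ij: "i \<in> W" "j \<in> E" "j \<notin> W"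
    show "\<not> gedge b E z i j"
    proof
      assume "gedge b E z i j"
      then obtain x where x: "x \<in> face E z" "edge b x i j"
        by (auto simp: gedge_def)
      have "j \<noteq> k"
        using sep2 x ij by blast
      have "x(j := u) \<in> face E z" for u
        using x ij by blast
      then have "\<not> edge b (x(j := u)) i k" for u
        using sep2 ij by blast
      moreover have "i \<noteq> j" "i \<noteq> k"
        using ij W by auto
      ultimately have "edge b (x(k := c)) i j"
        using edge_upd_other [of i j k b x c] x ij k W E \<open>b \<noteq> 0\<close> by blast
      moreover have "x(k := c) \<in> face (E - {k}) (z(k := c))"
        using x k face by auto
      ultimately show False
        using sep1 [OF ij(1)] ij \<open>j \<noteq> k\<close> by (auto simp: S_def gedge_def)
    qed
  qed (use W k in auto)
qed

text \<open>Moving \<open>w\<close> by \<open>e\<close> changes the colour of \<open>u\<close>,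
  \<open>v\<close> to \<open>a + e\<close> but preserves those of \<open>k\<close>, \<open>u\<close>
  and \<open>k\<close>, \<open>v\<close>. The triangle \<open>k\<close>, \<open>u\<close>,
  \<open>v\<close> then has the colours \<open>a\<close>, \<open>e\<close> and
  \<open>a + e\<close>.\<close>

lemma pentagon_free:
  assumes I: "k \<in> I" "u \<in> I" "v \<in> I" "w \<in> I"
    and ne: "k \<noteq> u" "k \<noteq> v" "k \<noteq> w" "u \<noteq> v" "u \<noteq> w" "v \<noteq> w"
    and a: "a \<noteq> 0" "off a e"
    and c: "col k u x = a" "col u w x = a" "col v w x = a" "col k v x = e" "col u v x = e" "col k w x = e"
  shows False
proof -
  let ?y = "mv w e x"
  have e: "e \<noteq> 0" "off e a"
    using a by (auto simp: off_def)
  have "col u v ?y = a + e"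
    using col_mv_toggle [of u v w x a e] I ne a c by simp
  moreover have "col u k ?y = a"
    using col_mv_stable [of u k w x a e] I ne a c col_sym [of u k x] by simp
  then have "col k u ?y = a"
    using col_sym [of u k ?y] I ne by simp
  moreover have "col k v ?y = e"
    using col_mv_stable [of k v w x e e] I ne e c by simp
  ultimately show False
    using col_not_rainbow [of k u v ?y] I ne a e by (auto simp: off_def)
qed

theorem exists_disconnected_label:
  assumes "E \<subseteq> I" "finite E" "2 \<le> card E"
  shows "\<exists>b. b \<noteq> 0 \<and> \<not> conn (gedge b E z) E"
  using assms
proof (induction "card E" arbitrary: E z rule: less_induct)
  case (less E)
  note E = \<open>E \<subseteq> I\<close> \<open>finite E\<close>
  show ?case
  proof (cases "card E = 2")
    case True
    then obtain i j where ij: "E = {i, j}" "i \<noteq> j"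
      by (meson card_2_iff)
    \<comment> \<open>With two coordinates the face is a single square, and its colour is the label.
      For colour \<open>0\<close> any nonzero label serves.\<close>
    define b where "b = (if col i j z = 0 then V1 else col i j z)"
    have same: "col i j x = col i j z" if "x \<in> face E z" for x
    proof -
      have "x = z(i := x i, j := x j)"
        using that by (auto simp: face_def ij fun_eq_iff)
      moreover have "col i j (z(i := x i, j := x j)) = col i j z"
        using E ij by simp
      ultimately show ?thesis by metis
    qed
    have "\<not> gedge b E z i j"
    proof
      assume "gedge b E z i j"
      then obtain x where "x \<in> face E z" "off b (col i j x)"
        by (auto simp: gedge_def ed_def)
      then have "off b (col i j z)"
        using same by metis
      then show False
        by (auto simp: b_def off_def split: if_splits)
    qed
    then have "\<not> conn (gedge b E z) E"
      using ij by (intro not_connI [of "{i}"]) auto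
    moreover have "b \<noteq> 0"
      by (simp add: b_def zero_v4_def)
    ultimately show ?thesis by blast
  next
    case False
    then have card3: "3 \<le> card E"
      using less.prems by simp
    show ?thesis
    proof (rule ccontr)
      assume "\<not> ?thesis"
      then have conn: "conn (gedge b E z) E" if "b \<noteq> 0" for b
        using that by blast

      \<comment> \<open>The claim at a single point. Proper subsets inherit it from the induction
        hypothesis, since local edges are global edges; for \<open>E\<close> itself one vertex is
        removed and put back by \<open>gallai_insert_vertex\<close>.\<close>
      have local_label: "\<exists>a. a \<noteq> 0 \<and> \<not> conn (edge a x) Y"
        if Y: "Y \<subseteq> E" "2 \<le> card Y" "conn (edge 0 x) Y" for x Y
      proof -
        have small: "\<exists>a. a \<noteq> 0 \<and> \<not> conn (edge a x) Y'" if Y': "Y' \<subseteq> E" "2 \<le> card Y'" "card Y' < card E" for Y'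
        proof -
          have "Y' \<subseteq> I" "finite Y'"
            using Y' E finite_subset by auto
          then obtain a where a: "a \<noteq> 0" "\<not> conn (gedge a Y' x) Y'"
            using less.hyps [OF Y'(3)] Y' by blast
          have "\<not> conn (edge a x) Y'"
          proof
            assume "conn (edge a x) Y'"
            then have "conn (gedge a Y' x) Y'"
              by (rule conn_mono) (auto simp: gedge_def intro!: bexI [of _ x])
            then show False using a by blast
          qed
          then show ?thesis using a by blast
        qed
        show ?thesis
        proof (cases "Y = E")
          case False
          then have "card Y < card E"
            using Y E by (simp add: psubset_card_mono psubset_eq)
          then show ?thesis
            using small Y by blast
        next
          case True
          have "\<exists>k\<in>E. conn (edge 0 x) (E - {k})"
            using Y E True edge_sym by (intro conn_remove_vertex) blast+
          then obtain k where k: "k \<in> E" "conn (edge 0 x) (E - {k})" by blast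
          have "card (E - {k}) = card E - 1"
            using k E by simp
          then have "2 \<le> card (E - {k})" "card (E - {k}) < card E"
            using card3 by simp_all
          then obtain a where a: "a \<noteq> 0" "\<not> conn (edge a x) (E - {k})"
            using small [of "E - {k}"] by blast
          have ins: "insert k (E - {k}) = E"
            using k by blast
          have "\<exists>b. b \<noteq> 0 \<and> \<not> conn (edge b x) (insert k (E - {k}))"
          proof (rule gallai_insert_vertex [OF _ _ a(1) k(2) a(2)])
            show "gallai (\<lambda>i j. col i j x) (insert k (E - {k}))"
              unfolding ins using E by (intro gallai_col)
            show "k \<notin> E - {k}" by simp
            fix u v w e
            assume "u \<in> E - {k}" "v \<in> E - {k}" "w \<in> E - {k}" "u \<noteq> v" "u \<noteq> w" "v \<noteq> w" "off a e"
              "col k u x = a" "col u w x = a" "col v w x = a" "col k v x = e" "col u v x = e" "col k w x = e"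
            then show False
              using pentagon_free [of k u v w a e x] k E a by blast
          qed
          then show ?thesis
            unfolding ins True .
        qed
      qed

      \<comment> \<open>Take a largest set that is connected at some point \<open>x\<close>, but not in the graph of label \<open>b\<close>.
        Its edges of colour \<open>b\<close> between different components survive moves of type \<open>b\<close>, so by
        maximality and \<open>local_label\<close> the set and its label do as well.\<close>
      define C where "C = (\<lambda>(x, b, Y). x \<in> face E z \<and> b \<noteq> 0 \<and> Y \<subseteq> E \<and> 2 \<le> card Y \<and>
        conn (edge 0 x) Y \<and> \<not> conn (edge b x) Y)"
      have "\<exists>x b Y. C (x, b, Y)"
      proof -
        obtain i where i: "i \<in> E"
          using card3 by fastforce
        have "{i} \<noteq> E"
          using card3 by auto
        then obtain j where j: "j \<in> E" "j \<noteq> i" "gedge V1 E z i j"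
          using connE [OF conn [of V1], of "{i}"] i by (auto simp: zero_v4_def)
        then obtain x where x: "x \<in> face E z" "edge V1 x i j"
          by (auto simp: gedge_def)
        define b where "b = col i j x"
        have "edge 0 x i j"
          using x by (auto simp: ed_def off_def)
        then have "conn (edge 0 x) {i, j}"
          using edge_sym i j E by (intro conn_pair) blast+
        moreover have "\<not> conn (edge b x) {i, j}"
          using j by (intro not_connI [of "{i}"]) (auto simp: ed_def b_def)
        moreover have "b \<noteq> 0"
          using x by (auto simp: ed_def off_def b_def)
        ultimately have "C (x, b, {i, j})"
          using x i j by (auto simp: C_def)
        then show ?thesis by blast
      qed
      moreover have "\<forall>t. C t \<longrightarrow> card (snd (snd t)) < Suc (card E)"
        using E by (auto simp: C_def less_Suc_eq_le intro!: card_mono)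
      ultimately have "\<exists>t. C t \<and> (\<forall>t'. C t' \<longrightarrow> card (snd (snd t')) \<le> card (snd (snd t)))"
        using ex_has_greatest_nat [of C _ "\<lambda>t. card (snd (snd t))" "Suc (card E)"] by blast
      then obtain x b Y where CxY: "C (x, b, Y)"
        and max: "\<And>x' b' Y'. C (x', b', Y') \<Longrightarrow> card Y' \<le> card Y"
        by auto
      have b: "b \<noteq> 0" and x: "x \<in> face E z" and YE: "Y \<subseteq> E" and YI: "Y \<subseteq> I" and cY: "2 \<le> card Y"
        using CxY E by (auto simp: C_def)
      have finY: "finite Y"
        using YE E finite_subset by blast

      \<comment> \<open>Otherwise \<open>insert j Y\<close> would be connected in nonzero colours,
        and \<open>local_label\<close> would turn it into a larger candidate.\<close>
      have isolated: "col k j y = 0" if "C (y, b, Y)" "j \<in> E - Y" "k \<in> Y" for y j k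
      proof (rule ccontr)
        assume "col k j y \<noteq> 0"
        then have e: "edge 0 y k j"
          using that by (auto simp: ed_def off_def)
        then have "edge 0 y j k"
          using edge_sym that YE E by blast
        then have "conn (edge 0 y) (insert j Y)"
          using that e by (intro conn_insert [of _ Y k j]) (auto simp: C_def)
        moreover have ins: "insert j Y \<subseteq> E" "card (insert j Y) = Suc (card Y)"
          using that YE finY by auto
        ultimately obtain a where "a \<noteq> 0" "\<not> conn (edge a y) (insert j Y)"
          using local_label [of "insert j Y" y] cY by auto
        then have "C (y, a, insert j Y)"
          using that ins \<open>conn (edge 0 y) (insert j Y)\<close> cY by (auto simp: C_def)
        then show False
          using max ins by fastforce
      qed

      have persist: "C (mv j b y, b, Y)" if C: "C (y, b, Y)" and j: "j \<in> E" for y j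
      proof -
        let ?y = "mv j b y"
        interpret G: gallai "\<lambda>i j. col i j y" Y
          using YI by (rule gallai_col)
        have cross: "conn (\<lambda>u v. u \<noteq> v \<and> col u v y = b \<and> v \<notin> component (edge b y) Y u) Y"
          using C by (intro G.conn_cross) (auto simp: C_def)
        have "conn (\<lambda>u v. u \<noteq> v \<and> col u v ?y = b) Y"
        proof (rule conn_mono [OF cross], intro conjI)
          fix u v assume uv: "u \<in> Y" "v \<in> Y" "u \<noteq> v \<and> col u v y = b \<and> v \<notin> component (edge b y) Y u"
          then show "u \<noteq> v" by blast
          show "col u v ?y = b"
          proof (rule col_mv_persist)
            assume ne: "u \<noteq> j" "v \<noteq> j"
            show "\<not> off b (col u j y) \<or> \<not> off b (col v j y)"
            proof (cases "j \<in> Y")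
              case True
              show ?thesis
              proof (rule ccontr)
                assume "\<not> ?thesis"
                then have "edge b y u j" "edge b y v j"
                  using ne by (auto simp: ed_def)
                then have "edge b y u j" "edge b y j v"
                  using edge_sym uv True YI by blast+
                then have "v \<in> component (edge b y) Y u"
                  using component_step component_self uv True by metis
                then show False using uv by blast
              qed
            next
              case False
              then show ?thesis
                using isolated [OF C, of j u] uv j by simp
            qed
          qed (use uv b j YI E in auto)
        qed
        \<comment> \<open>The pairs of colour \<open>b\<close> connect \<open>Y\<close>, so every
          label other than \<open>b\<close> is connected and the one found by
          \<open>local_label\<close> must be \<open>b\<close>.\<close>
        then have mono: "conn (edge a ?y) Y" if "a \<noteq> b" for a
          by (rule conn_mono) (use that b in \<open>auto simp: ed_def off_def\<close>)
        then have "conn (edge 0 ?y) Y"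
          using b by auto
        moreover from this obtain a where "a \<noteq> 0" "\<not> conn (edge a ?y) Y"
          using local_label YE cY by blast
        then have "\<not> conn (edge b ?y) Y"
          using mono [of a] by auto
        ultimately show ?thesis
          using C j by (auto simp: C_def)
      qed

      have level: "C (y, b, Y)" if y: "y \<in> face E z" "\<not> off b (f x + f y)" for y
      proof -
        have "reach b E x y"
          using reach_level_set [OF E conn [OF b] b x y] .
        then show ?thesis
          by (induction rule: reach_induct) (use CxY persist in auto)
      qed

      have "Y = E"
      proof (rule ccontr)
        assume "Y \<noteq> E"
        moreover have "Y \<noteq> {}"
          using cY by auto
        ultimately obtain i l where il: "i \<in> Y" "l \<in> E" "l \<notin> Y" "gedge b E z i l"
          using connE [OF conn [OF b], of Y] YE by metis
        then obtain w where w: "w \<in> face E z" "edge b w i l"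
          by (auto simp: gedge_def)
        \<comment> \<open>This move reaches the level of \<open>x\<close> without leaving the square
          of \<open>i\<close> and \<open>l\<close>, so it preserves the colour.\<close>
        let ?w = "mv i (f w + f x) w"
        have I: "i \<in> I" "l \<in> I" "i \<noteq> l"
          using il YI E by auto
        have "C (?w, b, Y)"
          using w il YE I by (intro level) (auto simp: ac_simps)
        then have "col i l ?w = 0"
          using isolated il by blast
        then show False
          using I w by (auto simp: ed_def)
      qed
      note level = level [unfolded \<open>Y = E\<close>]

      have "\<not> conn (gedge b (E - {k}) (z(k := c))) (E - {k})" if k: "k \<in> E" for k c
      proof
        define E' where "E' = E - {k}"
        define z' where "z' = z(k := c)"
        assume "conn (gedge b (E - {k}) (z(k := c))) (E - {k})"
        then have conn': "conn (gedge b E' z') E'"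
          by (simp add: E'_def z'_def)
        have E': "E' \<subseteq> I" "finite E'" "E' \<subseteq> E" "k \<notin> E'" "E = insert k E'"
          using E k by (auto simp: E'_def)
        have face': "y \<in> face E' z' \<longleftrightarrow> y k = c \<and> y \<in> face E z" for y
          unfolding E'_def z'_def using k by (intro face_slice)
        have cE': "card E' = card E - 1"
          using k E by (simp add: E'_def)
        then obtain a where a: "a \<noteq> 0" "\<not> conn (gedge a E' z') E'"
          using less.hyps [of E' z'] E' card3 by auto
        then have "a \<noteq> b"
          using conn' by blast
        obtain A where A: "A \<subseteq> E'" "A \<noteq> {}" "A \<noteq> E'"
          and sep: "\<And>i j. i \<in> A \<Longrightarrow> j \<in> E' \<Longrightarrow> j \<notin> A \<Longrightarrow> \<not> gedge a E' z' i j"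
          using a(2) by (rule not_connE) blast
        have cross: "col i j y = 0 \<or> col i j y = a"
          if "y \<in> face E' z'" "i \<in> A" "j \<in> E'" "j \<notin> A" for i j y
          using sep [OF that(2-4)] that by (auto simp: gedge_def ed_def off_def)
        have lev: "C (y, b, E)" if "y \<in> face E' z'" "\<not> off b (f x + f y)" for y
          using level that face' by blast

        \<comment> \<open>Between the two sides of the slice only the colours \<open>0\<close> and \<open>a\<close> occur, so a component that
          meets both sides can be joined by colour \<open>b\<close> to nothing but \<open>k\<close>.\<close>
        have star: "col r k y = b \<and> col s k y = b \<and> (\<forall>t\<in>E'. \<not> off b (col k t y))"
          if y: "y \<in> face E' z'" "\<not> off b (f x + f y)"
            and rs: "r \<in> A" "s \<in> E'" "s \<notin> A" "s \<in> component (edge b y) E r" for y r s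
        proof -
          interpret G: gallai "\<lambda>i j. col i j y" E
            using E by (intro gallai_col)
          have C: "conn (edge 0 y) E" "\<not> conn (edge b y) E"
            using lev [OF y] by (auto simp: C_def)
          have rE: "r \<in> E" "s \<in> E"
            using rs A E' by auto
          obtain w where w: "w \<in> E" "w \<notin> component (edge b y) E r"
            and wb: "\<forall>q\<in>component (edge b y) E r. col q w y = b"
            using G.cross_witness [OF C b rE(1)] by blast
          have rsw: "col r w y = b" "col s w y = b"
            using wb rs by auto
          have sw: "s \<noteq> w" "r \<noteq> w"
            using w rs by auto
          \<comment> \<open>A vertex of the slice lies opposite to \<open>r\<close> or to
            \<open>s\<close>, where the colour \<open>b\<close> does not occur.\<close>
          have "w = k"
          proof (rule ccontr)
            assume "w \<noteq> k"
            then have "w \<in> E'"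
              using w by (simp add: E'_def)
            then show False
              using cross [OF y(1), of w s] cross [OF y(1), of r w] rs rsw sw rE w b \<open>a \<noteq> b\<close>
                G.c_sym [of w s] by auto
          qed
          moreover have "\<not> off b (col k t y)" if t: "t \<in> E'" for t
          proof
            assume off: "off b (col k t y)"
            have tE: "t \<in> E" "k \<in> E" "t \<noteq> k"
              using t k by (auto simp: E'_def)
            have ekt: "edge b y t k"
              using off tE G.c_sym [of t k] by (auto simp: ed_def)
            have tr: "t \<notin> component (edge b y) E r"
              using component_step [of t "edge b y" E r k] tE ekt w \<open>w = k\<close> by blast
            \<comment> \<open>The only alternative is \<open>0\<close>, which would make the
              triangle \<open>q\<close>, \<open>t\<close>, \<open>k\<close> rainbow.\<close>
            have "col q t y = b" if q: "q \<in> component (edge b y) E r" "q \<in> E" for q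
            proof -
              have ne: "q \<noteq> t" "q \<noteq> k"
                using q tr w \<open>w = k\<close> by auto
              have "\<not> edge b y q t"
                using component_step [of q "edge b y" E r t] q tE tr by blast
              then have "\<not> off b (col q t y)"
                using ne by (simp add: ed_def)
              moreover have "col q k y = b"
                using wb q \<open>w = k\<close> by blast
              ultimately show ?thesis
                using G.no_rainbow [of q t k] q tE ne off G.c_sym [of t k] by (auto simp: off_def)
            qed
            then have "col r t y = b" "col s t y = b"
              using rs rE by auto
            moreover have "s \<noteq> t"
              using rs tr by blast
            ultimately show False
              using cross [OF y(1), of t s] cross [OF y(1), of r t] rs t rE tE b \<open>a \<noteq> b\<close>
                G.c_sym [of t s] by auto
          qed
          ultimately show ?thesis
            using rsw by blast
        qed

        obtain p q where pq: "p \<in> A" "q \<in> E'" "q \<notin> A" "gedge b E' z' p q"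
          using connE [OF conn' A] .
        then obtain w where w: "w \<in> face E' z'" "edge b w p q"
          by (auto simp: gedge_def)
        have pI: "p \<in> E'" "p \<in> I" "q \<in> I" "p \<noteq> q" "p \<in> E" "q \<in> E" "k \<in> I" "p \<noteq> k" "q \<noteq> k"
          using pq A E' E k by auto
        define z0 where "z0 = mv p (f w + f x) w"
        have z0: "z0 \<in> face E' z'" "\<not> off b (f x + f z0)" "edge b z0 p q"
          using w pI by (auto simp: z0_def ac_simps ed_def)
        \<comment> \<open>This state holds at \<open>z0\<close> by \<open>star\<close> and is
          carried by moves \<open>b\<close> inside the slice to all its points on the level of
          \<open>x\<close>. There \<open>k\<close> has no edges of label \<open>b\<close>, which
          contradicts the connectedness of \<open>E\<close>.\<close>
        define Inv where "Inv y \<longleftrightarrow> y \<in> face E' z' \<and> \<not> off b (f x + f y) \<and> col p k y = b \<and> col q k y = b \<and>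
          (\<forall>t\<in>E'. \<not> off b (col k t y))" for y
        have "Inv z0"
        proof -
          have "q \<in> component (edge b z0) E p"
            using component_step [of p "edge b z0" E p q] z0 pI by simp
          then show ?thesis
            using star [OF z0(1,2) pq(1-3)] z0 by (simp add: Inv_def)
        qed
        moreover have "Inv (mv j b y)" if Inv: "Inv y" and j: "j \<in> E'" for y j
        proof -
          let ?y = "mv j b y"
          have jI: "j \<in> I" "j \<noteq> k" "j \<in> E"
            using j E E' by auto
          have y: "y \<in> face E' z'" "\<not> off b (f x + f y)"
            using Inv by (auto simp: Inv_def)
          have y': "?y \<in> face E' z'" "\<not> off b (f x + f ?y)"
            using y j jI b by (auto simp: off_add simp flip: add.assoc)
          have keep: "col s k ?y = b" if s: "s \<in> E'" "col s k y = b" for s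
          proof (rule col_mv_persist)
            have "\<not> off b (col k j y)"
              using Inv j by (auto simp: Inv_def)
            then show "\<not> off b (col s j y) \<or> \<not> off b (col k j y)" by blast
          qed (use s b jI pI E' in auto)
          have kpq: "col p k ?y = b" "col q k ?y = b"
            using keep pI pq Inv by (auto simp: Inv_def)
          have "\<not> off b (col k t ?y)" if t: "t \<in> E'" for t
          proof
            assume off: "off b (col k t ?y)"
            have tI: "t \<in> I" "t \<noteq> k" "t \<in> E"
              using t E' E by auto
            have ckt: "col t k ?y = col k t ?y"
              using col_sym tI pI by blast
            have tpq: "t \<noteq> p" "t \<noteq> q"
              using off kpq ckt by auto
            show False
            proof (cases "t \<in> A")
              case True
              \<comment> \<open>Across the sides only \<open>0\<close> and \<open>a\<close> occur,
                and \<open>q\<close>, \<open>k\<close> have colour \<open>b\<close>, so the triangle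
                forces equality. The resulting edge across the sides makes \<open>star\<close>
                applicable, contrary to \<open>off\<close>.\<close>
              have "col t q ?y = col t k ?y"
                using cross [OF y'(1) True pq(2,3)] col_not_rainbow [of t q k ?y] tI pI tpq kpq off ckt \<open>a \<noteq> b\<close> b
                by (auto simp: off_def)
              then have "edge b ?y t q"
                using off ckt tpq by (simp add: ed_def)
              then have "q \<in> component (edge b ?y) E t"
                using component_step [of t "edge b ?y" E t q] tI pI by simp
              then show False
                using star [OF y' True pq(2,3)] off t by blast
            next
              case False
              have "col p t ?y = col t k ?y"
                using cross [OF y'(1) pq(1) t False] col_not_rainbow [of p t k ?y] tI pI tpq kpq off ckt \<open>a \<noteq> b\<close> b
                by (auto simp: off_def)
              then have "edge b ?y p t"
                using off ckt tpq by (simp add: ed_def)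
              then have "t \<in> component (edge b ?y) E p"
                using component_step [of p "edge b ?y" E p t] tI pI by simp
              then show False
                using star [OF y' pq(1) t False] off t by blast
            qed
          qed
          then show ?thesis
            using y' kpq by (simp add: Inv_def)
        qed
        ultimately have all_Inv: "Inv y" if "y \<in> face E' z'" "\<not> off b (f x + f y)" for y
        proof -
          have "\<not> off b (f z0 + f y)"
            using that z0 b by (simp add: off_add)
          then have "reach b E' z0 y"
            using reach_level_set [OF E'(1,2) conn' b z0(1) that(1)] by blast
          then show ?thesis
            by (induction rule: reach_induct) (use \<open>Inv z0\<close> \<open>\<And>j y. Inv y \<Longrightarrow> j \<in> E' \<Longrightarrow> Inv (mv j b y)\<close> in auto)
        qed
        have "{k} \<noteq> E"
          using pI by auto
        then obtain t where t: "t \<in> E" "t \<noteq> k" "gedge b E z k t"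
          using connE [OF conn [OF b], of "{k}"] k by auto
        then obtain w where w: "w \<in> face E z" "edge b w k t"
          by (auto simp: gedge_def)
        have tI: "t \<in> I" "t \<in> E'"
          using t E by (auto simp: E'_def)
        \<comment> \<open>Setting coordinate \<open>k\<close> to \<open>c\<close> and moving
          \<open>t\<close> to the level of \<open>x\<close> both stay in the square of
          \<open>k\<close> and \<open>t\<close>, so its colour is unchanged.\<close>
        let ?w = "mv t (f (w(k := c)) + f x) (w(k := c))"
        have "w(k := c) \<in> face E' z'"
          using face' w k by auto
        then have "Inv ?w"
          using tI by (intro all_Inv) (auto simp: ac_simps)
        then have "\<not> off b (col k t ?w)"
          using tI by (auto simp: Inv_def)
        then show False
          using w tI pI t by (auto simp: ed_def)
      qed
      then have "\<not> conn (gedge b E z) E"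
        using E card3 by (intro disconnected_of_slices [OF E _ b]) auto
      then show False
        using conn b by blast
    qed
  qed
qed

text \<open>Expresses that \<open>f\<close> is a composition on the face without naming the two
  factors: \<open>f\<close> itself, with the coordinates outside \<open>W\<close> held fixed, serves
  as the inner function.\<close>

definition splits :: "'i set \<Rightarrow> ('i \<Rightarrow> v4) \<Rightarrow> 'i set \<Rightarrow> bool" where
  "splits E z W \<longleftrightarrow> (\<forall>x\<in>face E z. \<forall>y\<in>face E z. \<forall>w\<in>face E z. (\<forall>j. j \<notin> W \<longrightarrow> x j = y j) \<longrightarrow> f x = f y \<longrightarrow>
     f (\<lambda>j. if j \<in> W then x j else w j) = f (\<lambda>j. if j \<in> W then y j else w j))"

theorem semilinear_or_splits:
  assumes E: "E \<subseteq> I" "finite E" "2 \<le> card E"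
  obtains (semilinear) b where "b \<noteq> 0" "\<And>i j. i \<in> E \<Longrightarrow> j \<in> E \<Longrightarrow> \<not> gedge b E z i j"
  | (split) W where "W \<subseteq> E" "W \<noteq> E" "2 \<le> card W" "splits E z W"
proof -
  obtain b where b: "b \<noteq> 0" "\<not> conn (gedge b E z) E"
    using exists_disconnected_label [OF E] by blast
  have sym: "gedge b E z j i" if "i \<in> E" "j \<in> E" "gedge b E z i j" for i j
    using that E gedge_sym by blast
  show ?thesis
  proof (cases "\<exists>i\<in>E. \<exists>j\<in>E. gedge b E z i j")
    case False
    then show ?thesis
      using semilinear b by blast
  next
    case True
    then obtain i j where ij: "i \<in> E" "j \<in> E" "gedge b E z i j" by blast
    define W where "W = component (gedge b E z) E i"
    have "W \<subseteq> E"
      unfolding W_def using ij(1) by (rule component_subset)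
    have ijW: "i \<in> W" "j \<in> W"
      using component_step [of i "gedge b E z" E i j] ij by (auto simp: W_def)
    have "i \<noteq> j"
      using ij by (auto simp: gedge_def ed_def)
    have "finite W"
      using \<open>W \<subseteq> E\<close> E finite_subset by blast
    then have "card {i, j} \<le> card W"
      using ijW by (intro card_mono) auto
    then have "2 \<le> card W"
      using \<open>i \<noteq> j\<close> by simp
    moreover have "W \<noteq> E"
      unfolding W_def using component_neq [OF sym b(2) ij(1)] .
    moreover have "splits E z W"
      unfolding splits_def
    proof (intro ballI impI)
      have "conn (gedge b E z) W"
        unfolding W_def by (rule conn_component [OF sym ij(1)])
      moreover have "\<not> gedge b E z u v" if "u \<in> W" "v \<in> E - W" for u v
        using that component_step [of u "gedge b E z" E i v] \<open>W \<subseteq> E\<close> unfolding W_def by blast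
      ultimately show "f (\<lambda>j. if j \<in> W then x j else w j) = f (\<lambda>j. if j \<in> W then y j else w j)"
        if "x \<in> face E z" "y \<in> face E z" "w \<in> face E z" "\<forall>j. j \<notin> W \<longrightarrow> x j = y j" "f x = f y" for x y w
        using split_of_component [OF E(1,2) b(1) \<open>W \<subseteq> E\<close>] that by blast
    qed
    ultimately show ?thesis
      using split \<open>W \<subseteq> E\<close> by blast
  qed
qed

end

section \<open>Counting transversals\<close>

lemma latin_subset: "latin f I \<Longrightarrow> W \<subseteq> I \<Longrightarrow> latin f W"
  unfolding latin_def by blast

definition pt :: "'i set \<Rightarrow> ('i \<Rightarrow> v4) \<Rightarrow> ('i \<Rightarrow> v4 \<Rightarrow> v4) \<Rightarrow> v4 \<Rightarrow> 'i \<Rightarrow> v4" where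
  "pt E z \<sigma> u = (\<lambda>i. if i \<in> E then \<sigma> i u else z i)"

text \<open>A transversal contains exactly one point with value \<open>u\<close> for every \<open>u\<close>, so it is encoded by the
  permutations \<open>\<sigma> i\<close> that send \<open>u\<close> to coordinate \<open>i\<close> of this point.\<close>

definition frames :: "(('i \<Rightarrow> v4) \<Rightarrow> v4) \<Rightarrow> 'i set \<Rightarrow> ('i \<Rightarrow> v4) \<Rightarrow> ('i \<Rightarrow> v4 \<Rightarrow> v4) set" where
  "frames f E z = {\<sigma> \<in> E \<rightarrow>\<^sub>E {s. bij s}. \<forall>u. f (pt E z \<sigma> u) = u}"

lemma framesD:
  assumes "\<sigma> \<in> frames f E z"
  shows "\<sigma> \<in> extensional E" "i \<in> E \<Longrightarrow> bij (\<sigma> i)" "f (pt E z \<sigma> u) = u"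
  using assms by (auto simp: frames_def PiE_def)

lemma finite_frames: "finite E \<Longrightarrow> finite (frames f E z)"
  unfolding frames_def by (intro finite_Collect_conjI disjI1) (auto intro: finite_PiE)

lemma bij_v4I: "inj (s :: v4 \<Rightarrow> v4) \<Longrightarrow> bij s"
  by (simp add: bij_def finite_UNIV_inj_surj)

lemma card_bij_v4: "card {s :: v4 \<Rightarrow> v4. bij s} = 24"
proof -
  have "{s :: v4 \<Rightarrow> v4. bij s} = {s. s permutes UNIV}"
    by (auto simp: permutes_def bij_iff)
  then show ?thesis
    using card_permutations [of "UNIV :: v4 set" 4] by (simp add: card_v4 fact_numeral)
qed

text \<open>For nonzero \<open>b\<close> these are the eight permutations that preserve the
  partition into cosets of \<open>{0, b}\<close>.\<close>

definition shear :: "v4 \<Rightarrow> v4 \<times> bool \<Rightarrow> v4 \<Rightarrow> v4" where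
  "shear b pe u = fst pe + u + (if snd pe \<and> off b u then b else 0)"

lemma shear_add_b: "b \<noteq> 0 \<Longrightarrow> shear b pe (u + b) = shear b pe u + b"
  by (simp add: shear_def off_add ac_simps)

lemma off_shear: "b \<noteq> 0 \<Longrightarrow> off b (shear b pe u + shear b pe v) = off b (u + v)"
  by (auto simp: shear_def off_add)

lemma not_off_cases: "\<not> off b (u + v) \<Longrightarrow> v = u \<or> v = u + b"
  by (metis off_def v4_add_eq_0_iff v4_add_self_left)

lemma inj_shear:
  assumes "b \<noteq> 0"
  shows "inj (shear b pe)"
proof (rule injI)
  fix u v assume eq: "shear b pe u = shear b pe v"
  then have "\<not> off b (u + v)"
    using off_shear [OF assms, of pe u v] by simp
  then show "u = v"
    using not_off_cases [of b u v] shear_add_b [OF assms, of pe u] eq assms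
    by (metis add.right_neutral add_left_cancel)
qed

lemma shear_eq_iff: "shear b pe = shear b pe' \<longleftrightarrow> pe = pe'" if "b \<noteq> 0"
proof
  assume eq: "shear b pe = shear b pe'"
  obtain c where "off b c"
    using ex_off by blast
  then show "pe = pe'"
    using fun_cong [OF eq, of 0] fun_cong [OF eq, of c] that
    by (cases pe; cases pe') (auto simp: shear_def split: if_splits)
qed simp

section \<open>Transversals of semilinear functions\<close>

context latin
begin

lemma semilinear_line:
  assumes E: "E \<subseteq> I" "finite E" and "b \<noteq> 0"
    and no_edge: "\<And>i j. i \<in> E \<Longrightarrow> j \<in> E \<Longrightarrow> \<not> gedge b E z i j"
    and i: "i \<in> E" and w: "w \<in> face E z"
  shows "off b (f (w(i := v)) + f (w(i := v'))) = off b (f (z(i := v)) + f (z(i := v')))"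
proof (rule face_induct [OF E(2) face_self w])
  fix w k t
  assume w: "w \<in> face E z" and k: "k \<in> E"
    and IH: "off b (f (w(i := v)) + f (w(i := v'))) = off b (f (z(i := v)) + f (z(i := v')))"
  show "off b (f (w(k := t, i := v)) + f (w(k := t, i := v'))) = off b (f (z(i := v)) + f (z(i := v')))"
  proof (cases "k = i")
    case True
    then show ?thesis using IH by simp
  next
    case False
    have "w(i := v') \<in> face E z"
      using w i by blast
    then have "\<not> edge b (w(i := v')) i k"
      using no_edge [OF i k] by (auto simp: gedge_def)
    then show ?thesis
      using not_edge_additive [of i k b "w(i := v')" v t] E i k False IH \<open>b \<noteq> 0\<close>
      by (simp add: fun_upd_twist subset_iff)
  qed
qed simp

text \<open>On all coordinates but \<open>k\<close> the shears are chosen freely, eight for each,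
  and coordinate \<open>k\<close> is forced by the value. Since \<open>card F\<close> is even, the
  function obtained at \<open>k\<close> is injective.\<close>

lemma semilinear_frames:
  assumes E: "E \<subseteq> I" "finite E" and "b \<noteq> 0"
    and no_edge: "\<And>i j. i \<in> E \<Longrightarrow> j \<in> E \<Longrightarrow> \<not> gedge b E z i j"
    and odd: "odd (card E)"
  shows "8 ^ (card E - 1) \<le> card (frames f E z)"
proof -
  have "E \<noteq> {}"
    using odd by auto
  then obtain k where k: "k \<in> E" by blast
  define F where "F = E - {k}"
  have F: "finite F" "F \<subseteq> E" "k \<notin> F" "card F = card E - 1" "even (card F)" "F \<subseteq> I"
    using E k odd by (auto simp: F_def)
  define base where "base \<tau> u = (\<lambda>i. if i \<in> F then val i (shear b (\<tau> i) u) z else z i)" for \<tau> u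
  define fr where "fr \<tau> = restrict (\<lambda>i u. if i = k then val k (u + f (base \<tau> u)) (base \<tau> u)
    else val i (shear b (\<tau> i) u) z) E" for \<tau>
  have pt_fr: "pt E z (fr \<tau>) u = mv k (u + f (base \<tau> u)) (base \<tau> u)" for \<tau> u
    using k F by (auto simp: pt_def fr_def base_def mv_def F_def fun_eq_iff)
  have base_face: "(base \<tau> u)(k := v) \<in> face E z" for \<tau> u v
    using F k by (auto simp: base_def face_def)
  have f_fr: "f (pt E z (fr \<tau>) u) = u" for \<tau> u
    using k E by (simp add: pt_fr subset_iff ac_simps)
  have step: "off b (f w + f (w(i := val i a' z))) = off b (a + a')"
    if "w \<in> face E z" "i \<in> E" "w i = val i a z" for w i a a'
  proof -
    have "w(i := val i a z) = w"
      using that(3) by (metis fun_upd_triv)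
    then show ?thesis
      using semilinear_line [OF E \<open>b \<noteq> 0\<close> no_edge that(2,1), of "val i a z" "val i a' z"] that(2) E
      by (simp add: subset_iff ac_simps)
  qed
  have step_b: "f (w(i := val i (a + b) z)) = f w + b"
    if "w \<in> face E z" "i \<in> E" "w i = val i a z" for w i a
  proof -
    have "\<not> off b (f w + f (w(i := val i (a + b) z)))"
      using step [OF that, of "a + b"] by simp
    moreover have "f (w(i := val i (a + b) z)) \<noteq> f (w(i := w i))"
      using that E \<open>b \<noteq> 0\<close> by (simp add: line_eq_iff val_inj subset_iff del: fun_upd_triv)
    ultimately show ?thesis
      using not_off_cases by fastforce
  qed
  have bij_k: "bij (fr \<tau> k)" for \<tau>
  proof (rule bij_v4I, rule injI)
    fix u u' assume eq: "fr \<tau> k u = fr \<tau> k u'"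
    define v where "v = fr \<tau> k u"
    define y where "y t = (base \<tau> t)(k := v)" for t
    have fy: "f (y u) = u" "f (y u') = u'"
    proof -
      have "y u = pt E z (fr \<tau>) u" "y u' = pt E z (fr \<tau>) u'"
        using k eq unfolding pt_fr by (simp_all add: y_def v_def mv_def fr_def)
      then show "f (y u) = u" "f (y u') = u'"
        by (simp_all add: f_fr)
    qed
    \<comment> \<open>Passing from \<open>y u\<close> to \<open>y u'\<close> one coordinate at a
      time changes the class of \<open>f\<close> modulo \<open>{0, b}\<close> by that of
      \<open>u + u'\<close> at each step. An even number of steps cancels.\<close>
    define mix where "mix A = (\<lambda>i. if i \<in> A then y u' i else y u i)" for A
    have mix_face: "mix A \<in> face E z" for A
      using base_face by (auto simp: mix_def y_def face_def)
    have mix_insert: "mix (insert i A) = (mix A)(i := val i (shear b (\<tau> i) u') z)"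
      "mix A i = val i (shear b (\<tau> i) u) z" if "i \<in> F" "i \<notin> A" for i A
      using that F by (auto simp: mix_def y_def base_def fun_eq_iff)
    have "off b (f (y u) + f (mix A)) = (odd (card A) \<and> off b (u + u'))" if "A \<subseteq> F" for A
      using finite_subset [OF that F(1)] that
    proof (induction A rule: finite_induct)
      case empty
      then show ?case by (simp add: mix_def)
    next
      case (insert i A)
      have iF: "i \<in> F" "i \<in> E"
        using insert F by auto
      have "off b (f (mix A) + f (mix (insert i A))) = off b (u + u')"
        using step [OF mix_face iF(2) mix_insert(2)] iF insert mix_insert(1) off_shear [OF \<open>b \<noteq> 0\<close>] by simp
      then show ?case
        using insert \<open>b \<noteq> 0\<close> by (auto simp: off_add)
    qed
    from this [of F] have "\<not> off b (f (y u) + f (mix F))"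
      using F(5) by simp
    moreover have mixF: "mix F = y u'"
      by (auto simp: mix_def y_def base_def fun_eq_iff)
    ultimately have "u' = u \<or> u' = u + b"
      using fy not_off_cases by simp
    then show "u = u'"
    proof
      assume u': "u' = u + b"
      \<comment> \<open>In the remaining case each step adds exactly \<open>b\<close>, and again an
        even number of steps cancels.\<close>
      have "f (mix A) = f (y u) + (if odd (card A) then b else 0)" if "A \<subseteq> F" for A
        using finite_subset [OF that F(1)] that
      proof (induction A rule: finite_induct)
        case empty
        then show ?case by (simp add: mix_def)
      next
        case (insert i A)
        have iF: "i \<in> F" "i \<in> E"
          using insert F by auto
        have "f (mix (insert i A)) = f (mix A) + b"
          using step_b [OF mix_face iF(2) mix_insert(2)] iF insert mix_insert(1) shear_add_b [OF \<open>b \<noteq> 0\<close>]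
          by (simp add: u')
        then show ?case
          using insert by (simp add: ac_simps)
      qed
      from this [of F] show ?thesis
        using F(5) fy mixF by simp
    qed simp
  qed
  have bij_F: "bij (fr \<tau> i)" if "i \<in> F" for \<tau> i
  proof (rule bij_v4I, rule injI)
    have i: "i \<in> E" "i \<in> I" "i \<noteq> k"
      using that F by auto
    fix u u' assume "fr \<tau> i u = fr \<tau> i u'"
    then have "shear b (\<tau> i) u = shear b (\<tau> i) u'"
      using i by (simp add: fr_def val_inj)
    then show "u = u'"
      by (rule injD [OF inj_shear [OF \<open>b \<noteq> 0\<close>]])
  qed
  have "fr \<tau> \<in> frames f E z" for \<tau>
  proof -
    have "bij (fr \<tau> i)" if "i \<in> E" for i
      using bij_k bij_F that by (cases "i = k") (auto simp: F_def)
    then show ?thesis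
      using f_fr unfolding frames_def by (auto simp: fr_def PiE_def)
  qed
  moreover have "inj_on fr (F \<rightarrow>\<^sub>E (UNIV :: (v4 \<times> bool) set))"
  proof (rule inj_onI)
    fix \<tau> \<tau>' assume t: "\<tau> \<in> F \<rightarrow>\<^sub>E (UNIV :: (v4 \<times> bool) set)" "\<tau>' \<in> F \<rightarrow>\<^sub>E (UNIV :: (v4 \<times> bool) set)"
      and eq: "fr \<tau> = fr \<tau>'"
    show "\<tau> = \<tau>'"
    proof (rule PiE_ext [OF t])
      fix i assume i: "i \<in> F"
      then have "i \<noteq> k" "i \<in> E" "i \<in> I"
        using F by auto
      then have "val i (shear b (\<tau> i) u) z = val i (shear b (\<tau>' i) u) z" for u
        using fun_cong [OF fun_cong [OF eq, of i], of u] by (simp add: fr_def)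
      then have "shear b (\<tau> i) = shear b (\<tau>' i)"
        using \<open>i \<in> I\<close> by (auto simp: val_inj)
      then show "\<tau> i = \<tau>' i"
        using \<open>b \<noteq> 0\<close> by (simp add: shear_eq_iff)
    qed
  qed
  ultimately have "card (F \<rightarrow>\<^sub>E (UNIV :: (v4 \<times> bool) set)) \<le> card (frames f E z)"
    using finite_frames [OF E(2)] by (intro card_inj_on_le) auto
  moreover have "card (UNIV :: (v4 \<times> bool) set) = 8"
    unfolding UNIV_Times_UNIV [symmetric] card_cartesian_product by (simp add: card_v4)
  ultimately show ?thesis
    using F by (simp add: card_PiE)
qed

section \<open>Transversals of compositions\<close>

lemma split_frames_odd:
  assumes E: "E \<subseteq> I" "finite E" and W: "W \<subseteq> E" "splits E z W" and k: "k \<in> W"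
  shows "card (frames f W z) * card (frames f (insert k (E - W)) z) \<le> card (frames f E z)"
proof -
  define J where "J = E - W"
  have kI: "k \<in> I"
    using k W E by auto
  define \<rho> where "\<rho> s u = f (z(k := s k u))" for s :: "'i \<Rightarrow> v4 \<Rightarrow> v4" and u
  define \<Phi> where "\<Phi> = (\<lambda>(r, s). restrict (\<lambda>i u. if i \<in> W then r i (\<rho> s u) else s i u) E)"
  have bij\<rho>: "bij (\<rho> s)" if "s \<in> frames f (insert k J) z" for s
  proof (rule bij_v4I, rule injI)
    fix u v assume "\<rho> s u = \<rho> s v"
    then have "s k u = s k v"
      using kI by (simp add: \<rho>_def line_eq_iff)
    then show "u = v"
      using framesD(2) [OF that, of k] by (auto simp: bij_def dest: injD)
  qed
  have ptW: "pt W z (\<Phi> (r, s)) u = pt W z r (\<rho> s u)" for r s u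
    using W by (auto simp: pt_def \<Phi>_def fun_eq_iff)
  have mem: "\<Phi> (r, s) \<in> frames f E z" if r: "r \<in> frames f W z" and s: "s \<in> frames f (insert k J) z" for r s
  proof -
    have "f (pt E z (\<Phi> (r, s)) u) = u" for u
    proof -
      let ?x = "pt W z r (\<rho> s u)" and ?y = "z(k := s k u)" and ?w = "pt (insert k J) z s u"
      have "?x \<in> face E z" "?y \<in> face E z" "?w \<in> face E z"
        using W k by (auto simp: face_def pt_def J_def)
      moreover have "\<forall>j. j \<notin> W \<longrightarrow> ?x j = ?y j"
        using k by (auto simp: pt_def)
      moreover have "f ?x = f ?y"
        using framesD(3) [OF r] by (simp add: \<rho>_def)
      ultimately have "f (\<lambda>j. if j \<in> W then ?x j else ?w j) = f (\<lambda>j. if j \<in> W then ?y j else ?w j)"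
        using W(2) unfolding splits_def by blast
      moreover have "(\<lambda>j. if j \<in> W then ?x j else ?w j) = pt E z (\<Phi> (r, s)) u"
        using W k by (auto simp: pt_def \<Phi>_def J_def fun_eq_iff)
      moreover have "(\<lambda>j. if j \<in> W then ?y j else ?w j) = ?w"
        using k by (auto simp: pt_def J_def fun_eq_iff)
      ultimately show ?thesis
        using framesD(3) [OF s] by metis
    qed
    moreover have "bij (\<Phi> (r, s) i)" if "i \<in> E" for i
    proof (cases "i \<in> W")
      case True
      have "bij (r i \<circ> \<rho> s)"
        using bij_comp [OF bij\<rho> [OF s] framesD(2) [OF r True]] .
      then show ?thesis
        using True that by (simp add: \<Phi>_def comp_def)
    next
      case False
      then show ?thesis
        using framesD(2) [OF s, of i] that by (simp add: \<Phi>_def J_def)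
    qed
    ultimately show ?thesis
      by (auto simp: frames_def \<Phi>_def PiE_def)
  qed
  have "inj_on \<Phi> (frames f W z \<times> frames f (insert k J) z)"
  proof (rule inj_onI, clarify)
    fix r s r' s'
    assume rs: "r \<in> frames f W z" "s \<in> frames f (insert k J) z" "r' \<in> frames f W z" "s' \<in> frames f (insert k J) z"
      and eq: "\<Phi> (r, s) = \<Phi> (r', s')"
    \<comment> \<open>The inner values can be recovered by evaluating \<open>f\<close> on the
      coordinates in \<open>W\<close> alone.\<close>
    have "\<rho> s u = \<rho> s' u" for u
      using ptW [of r s u] ptW [of r' s' u] eq framesD(3) [OF rs(1), of "\<rho> s u"] framesD(3) [OF rs(3), of "\<rho> s' u"]
      by metis
    then have \<rho>: "\<rho> s = \<rho> s'" by blast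
    have "s = s'"
    proof (rule extensionalityI [OF framesD(1) [OF rs(2)] framesD(1) [OF rs(4)]])
      fix i assume i: "i \<in> insert k J"
      show "s i = s' i"
      proof (cases "i = k")
        case True
        have "s k u = s' k u" for u
          using fun_cong [OF \<rho>, of u] kI by (simp add: \<rho>_def line_eq_iff)
        then show ?thesis using True by blast
      next
        case False
        then have "i \<in> E" "i \<notin> W"
          using i by (auto simp: J_def)
        then show ?thesis
          using fun_cong [OF eq, of i] by (simp add: \<Phi>_def)
      qed
    qed
    moreover have "r = r'"
    proof (rule extensionalityI [OF framesD(1) [OF rs(1)] framesD(1) [OF rs(3)]])
      fix i assume i: "i \<in> W"
      have "r i (\<rho> s u) = r' i (\<rho> s u)" for u
        using fun_cong [OF fun_cong [OF eq, of i], of u] i W \<rho> by (auto simp: \<Phi>_def)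
      then show "r i = r' i"
        using bij_is_surj [OF bij\<rho> [OF rs(2)]] by (metis ext surjD)
    qed
    ultimately show "r = r' \<and> s = s'" by blast
  qed
  moreover have "\<Phi> ` (frames f W z \<times> frames f (insert k J) z) \<subseteq> frames f E z"
    using mem by auto
  ultimately have "card (frames f W z \<times> frames f (insert k J) z) \<le> card (frames f E z)"
    using finite_frames [OF E(2)] by (rule card_inj_on_le)
  then show ?thesis
    by (simp add: card_cartesian_product J_def)
qed

text \<open>Presents the level set \<open>f = u\<close> on the face of \<open>W\<close> as the graph
  of coordinate \<open>k\<close> over the others. A frame of \<open>solve W z k u\<close> consists
  of four points with inner value \<open>u\<close> that differ pairwise in every coordinate of
  \<open>W\<close>.\<close>

definition solve :: "'i set \<Rightarrow> ('i \<Rightarrow> v4) \<Rightarrow> 'i \<Rightarrow> v4 \<Rightarrow> ('i \<Rightarrow> v4) \<Rightarrow> v4" where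
  "solve W z k u x = (let y = (\<lambda>i. if i \<in> W then x i else z i) in val k (f y + u) y)"

lemma f_solve:
  assumes "k \<in> I"
  shows "f ((\<lambda>i. if i \<in> W then x i else z i)(k := solve W z k u x)) = u"
  using assms by (simp add: solve_def Let_def)

lemma latin_solve:
  assumes "W \<subseteq> I" "k \<in> W"
  shows "latin (solve W z k u) (W - {k})"
proof
  fix i x assume i: "i \<in> W - {k}"
  show "bij (\<lambda>v. solve W z k u (x(i := v)))"
  proof (rule bij_v4I, rule injI)
    fix v v' assume eq: "solve W z k u (x(i := v)) = solve W z k u (x(i := v'))"
    define t where "t = solve W z k u (x(i := v))"
    let ?y = "(\<lambda>i. if i \<in> W then x i else z i)(k := t)"
    have upd: "(\<lambda>j. if j \<in> W then (x(i := w)) j else z j)(k := t) = ?y(i := w)" for w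
      using i by (auto simp: fun_eq_iff)
    have "f (?y(i := v)) = u"
      using f_solve [of k W "x(i := v)" z u] assms unfolding t_def [symmetric] upd by blast
    moreover have "f (?y(i := v')) = u"
      using f_solve [of k W "x(i := v')" z u] assms unfolding eq [symmetric] t_def [symmetric] upd by blast
    ultimately show "v = v'"
      using line_eq_iff [of i ?y v v'] i assms by auto
  qed
qed

text \<open>The factor is \<open>96 = 4 * 24\<close>: the constant inner value \<open>u\<close> can
  be chosen in 4 ways, and 24 bijections match the four points on \<open>W\<close> with the four
  points outside.\<close>

lemma split_frames_even:
  assumes E: "E \<subseteq> I" "finite E" and W: "W \<subseteq> E" "splits E z W" and k: "k \<in> W"
    and m: "\<And>u. m \<le> card (frames (solve W z k u) (W - {k}) z)"
    and n: "\<And>z'. n \<le> card (frames f (E - W) z')"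
  shows "96 * (m * n) \<le> card (frames f E z)"
proof -
  define J where "J = E - W"
  have kI: "k \<in> I"
    using k W E by auto
  \<comment> \<open>A representative with inner value \<open>u\<close>; the outer part is counted
    with the coordinates in \<open>W\<close> fixed to it.\<close>
  define x0 where "x0 u = mv k (f z + u) z" for u
  define S where "S u = frames (solve W z k u) (W - {k}) z \<times> frames f J (x0 u) \<times> {s :: v4 \<Rightarrow> v4. bij s}" for u
  define \<Phi> where "\<Phi> = (\<lambda>(u :: v4, r :: 'i \<Rightarrow> v4 \<Rightarrow> v4, s :: 'i \<Rightarrow> v4 \<Rightarrow> v4, \<rho> :: v4 \<Rightarrow> v4).
    restrict (\<lambda>i v. if i = k then \<rho> v else if i \<in> W then r i (\<rho> v) else s i v) E)"
  have fx0: "f (x0 u) = u" for u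
    using kI by (simp add: x0_def)
  define xW where "xW r t = (pt (W - {k}) z r t)(k := t)" for r t
  have fxW: "f (xW r t) = u" if r: "r \<in> frames (solve W z k u) (W - {k}) z" for r u t
  proof -
    let ?p = "pt (W - {k}) z r t"
    have "(\<lambda>i. if i \<in> W then ?p i else z i) = ?p"
      by (auto simp: pt_def)
    then show ?thesis
      using f_solve [OF kI, of W ?p z u] framesD(3) [OF r, of t] by (simp add: xW_def)
  qed
  have ptW: "pt W z (\<Phi> (u, r, s, \<rho>)) v = xW r (\<rho> v)" for u r s \<rho> v
    using W k by (auto simp: pt_def xW_def \<Phi>_def fun_eq_iff)
  have mem: "\<Phi> (u, r, s, \<rho>) \<in> frames f E z"
    if r: "r \<in> frames (solve W z k u) (W - {k}) z" and s: "s \<in> frames f J (x0 u)" and \<rho>: "bij \<rho>" for u r s \<rho>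
  proof -
    have "f (pt E z (\<Phi> (u, r, s, \<rho>)) v) = v" for v
    proof -
      let ?x = "xW r (\<rho> v)" and ?w = "pt J (x0 u) s v"
      have "?x \<in> face E z" "x0 u \<in> face E z" "?w \<in> face E z"
        using W k by (auto simp: face_def pt_def J_def xW_def x0_def mv_def)
      moreover have "\<forall>j. j \<notin> W \<longrightarrow> ?x j = x0 u j"
        using k by (auto simp: pt_def xW_def x0_def mv_def)
      moreover have "f ?x = f (x0 u)"
        using fxW [OF r] fx0 by simp
      ultimately have "f (\<lambda>j. if j \<in> W then ?x j else ?w j) = f (\<lambda>j. if j \<in> W then x0 u j else ?w j)"
        using W(2) unfolding splits_def by blast
      moreover have "(\<lambda>j. if j \<in> W then ?x j else ?w j) = pt E z (\<Phi> (u, r, s, \<rho>)) v"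
        using W k by (auto simp: pt_def \<Phi>_def J_def xW_def x0_def mv_def fun_eq_iff)
      moreover have "(\<lambda>j. if j \<in> W then x0 u j else ?w j) = ?w"
        by (auto simp: pt_def J_def fun_eq_iff)
      ultimately show ?thesis
        using framesD(3) [OF s] by metis
    qed
    moreover have "bij (\<Phi> (u, r, s, \<rho>) i)" if "i \<in> E" for i
    proof (cases "i \<in> W")
      case True
      show ?thesis
      proof (cases "i = k")
        case False
        then have "bij (r i \<circ> \<rho>)"
          using bij_comp [OF \<rho> framesD(2) [OF r, of i]] True by simp
        then show ?thesis
          using True False that by (simp add: \<Phi>_def comp_def)
      qed (use \<rho> that in \<open>simp add: \<Phi>_def\<close>)
    next
      case False
      then show ?thesis
        using framesD(2) [OF s, of i] that k by (cases "i = k") (simp_all add: \<Phi>_def J_def)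
    qed
    ultimately show ?thesis
      by (auto simp: frames_def \<Phi>_def PiE_def)
  qed
  have "inj_on \<Phi> (SIGMA u : UNIV. S u)"
  proof (rule inj_onI)
    fix t t' assume tt: "t \<in> Sigma UNIV S" "t' \<in> Sigma UNIV S" "\<Phi> t = \<Phi> t'"
    obtain u r s \<rho> where t: "t = (u, r, s, \<rho>)"
      by (cases t)
    obtain u' r' s' \<rho>' where t': "t' = (u', r', s', \<rho>')"
      by (cases t')
    note eq = tt(3) [unfolded t t']
    have rs: "r \<in> frames (solve W z k u) (W - {k}) z" "s \<in> frames f J (x0 u)" "bij \<rho>"
      "r' \<in> frames (solve W z k u') (W - {k}) z" "s' \<in> frames f J (x0 u')" "bij \<rho>'"
      using tt(1,2) unfolding t t' by (auto simp: S_def)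
    have "k \<in> E"
      using k W by blast
    then have \<rho>: "\<rho> = \<rho>'"
      using fun_cong [OF eq, of k] by (simp add: \<Phi>_def)
    have u: "u = u'"
      using ptW [of u r s \<rho> 0] ptW [of u' r' s' \<rho>' 0] eq fxW [OF rs(1), of "\<rho> 0"] fxW [OF rs(4), of "\<rho>' 0"] by metis
    have "s = s'"
    proof (rule extensionalityI [OF framesD(1) [OF rs(2)] framesD(1) [OF rs(5)]])
      fix i assume "i \<in> J"
      then have "i \<in> E" "i \<notin> W" "i \<noteq> k"
        using k by (auto simp: J_def)
      then show "s i = s' i"
        using fun_cong [OF eq, of i] by (simp add: \<Phi>_def)
    qed
    moreover have "r = r'"
    proof (rule extensionalityI [OF framesD(1) [OF rs(1)] framesD(1) [OF rs(4)]])
      fix i assume i: "i \<in> W - {k}"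
      have "r i (\<rho> v) = r' i (\<rho> v)" for v
        using fun_cong [OF fun_cong [OF eq, of i], of v] i W \<rho> by (auto simp: \<Phi>_def)
      then show "r i = r' i"
        using bij_is_surj [OF rs(3)] by (metis ext surjD)
    qed
    ultimately show "t = t'"
      using u \<rho> t t' by blast
  qed
  moreover have "\<Phi> ` (SIGMA u : UNIV. S u) \<subseteq> frames f E z"
    using mem by (auto simp: S_def)
  ultimately have le: "card (SIGMA u : UNIV. S u) \<le> card (frames f E z)"
    using finite_frames [OF E(2)] by (rule card_inj_on_le)
  have finS: "finite (S u)" for u
    using E(2) finite_subset [OF W(1)] unfolding S_def J_def
    by (intro finite_cartesian_product finite_frames) auto
  have "m * n * 24 \<le> card (S u)" for u
    using mult_le_mono [OF m [of u] n [of "x0 u"]]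
    by (simp add: S_def J_def card_cartesian_product card_bij_v4 mult.assoc [symmetric])
  then have "(\<Sum>u\<in>(UNIV :: v4 set). m * n * 24) \<le> (\<Sum>u\<in>UNIV. card (S u))"
    by (intro sum_mono) simp
  also have "\<dots> = card (SIGMA u : UNIV. S u)"
    using finS by (simp add: card_SigmaI)
  finally show ?thesis
    using le by (simp add: card_v4)
qed

end

text \<open>Both \<open>f\<close> and \<open>z\<close> vary in the induction, as the even case uses
  the functions \<open>solve W z k u\<close> and faces through other base points.\<close>

theorem card_frames_ge:
  assumes "latin f E" "finite E" "odd (card E)"
  shows "8 ^ (card E - 1) \<le> card (frames f E z)"
  using assms
proof (induction "card E" arbitrary: f E z rule: less_induct)
  case (less E f z)
  interpret latin f E by fact
  show ?case
  proof (cases "card E = 1")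
    case True
    then obtain i where i: "E = {i}"
      using card_1_singletonE by blast
    show ?thesis
    proof (rule semilinear_frames)
      \<comment> \<open>A single coordinate admits no edges, so any nonzero label serves.\<close>
      show "\<not> gedge V1 E z j k" if "j \<in> E" "k \<in> E" for j k
        using that i by (auto simp: gedge_def ed_def)
    qed (use less.prems in \<open>auto simp: zero_v4_def\<close>)
  next
    case False
    then have card2: "2 \<le> card E"
      using less.prems by (cases "card E") auto
    show ?thesis
      using subset_refl [of E] \<open>finite E\<close> card2
    proof (cases rule: semilinear_or_splits [where z = z])
      case (semilinear b)
      then show ?thesis
        using less.prems by (intro semilinear_frames [of E b]) auto
    next
      case (split W)
      then obtain k where k: "k \<in> W"
        by (metis card.empty equals0I not_numeral_le_zero)
      have fin: "finite W" "finite (E - W)"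
        using split less.prems finite_subset by auto
      have card: "card W + card (E - W) = card E"
        using split less.prems by (simp add: card_Diff_subset card_mono fin)
      have J: "card (E - W) \<noteq> 0"
        using split fin by auto
      have par: "even (card (E - W)) \<longleftrightarrow> odd (card W)"
        using less.prems(3) unfolding card [symmetric] by (simp add: even_add)
      have lt: "card W < card E" "card (E - W) < card E" "Suc (card (E - W)) < card E"
        using card J split by linarith+
      show ?thesis
      proof (cases "odd (card W)")
        case True
        have cJ: "card (insert k (E - W)) = Suc (card (E - W))"
          using k fin by simp
        have "8 ^ (card W - 1) \<le> card (frames f W z)"
          using True split(1) fin less.prems lt
          by (intro less.hyps latin_subset [OF less.prems(1)]) auto
        moreover have "8 ^ (card (insert k (E - W)) - 1) \<le> card (frames f (insert k (E - W)) z)"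
          using True split(1) fin less.prems lt cJ k par
          by (intro less.hyps latin_subset [OF less.prems(1)]) auto
        ultimately have "8 ^ (card W - 1) * 8 ^ card (E - W)
            \<le> card (frames f W z) * card (frames f (insert k (E - W)) z)"
          using cJ by (intro mult_le_mono) auto
        also have "\<dots> \<le> card (frames f E z)"
          using split k less.prems by (intro split_frames_odd) auto
        also have "(8 :: nat) ^ (card W - 1) * 8 ^ card (E - W) = 8 ^ (card E - 1)"
          using split card by (simp flip: power_add) 
        finally show ?thesis .
      next
        case False
        have cW: "card (W - {k}) = card W - 1"
          using k fin by simp
        have "8 ^ (card (W - {k}) - 1) \<le> card (frames (solve W z k u) (W - {k}) z)" for u
          using False split(1,3) fin less.prems lt cW k
          by (intro less.hyps latin_solve) auto
        moreover have "8 ^ (card (E - W) - 1) \<le> card (frames f (E - W) z')" for z'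
          using False split(1) fin less.prems lt par
          by (intro less.hyps latin_subset [OF less.prems(1)]) auto
        ultimately have "96 * (8 ^ (card (W - {k}) - 1) * 8 ^ (card (E - W) - 1)) \<le> card (frames f E z)"
          using split k less.prems by (intro split_frames_even [of E W z k]) auto
        \<comment> \<open>The two exponents add up to \<open>card E - 3\<close>; the missing
          \<open>64\<close> is covered by \<open>96\<close>.\<close>
        moreover have "card E - 1 = Suc (Suc ((card (W - {k}) - 1) + (card (E - W) - 1)))"
          using split card cW J by simp
        then have "(8 :: nat) ^ (card E - 1) = 64 * (8 ^ (card (W - {k}) - 1) * 8 ^ (card (E - W) - 1))"
          by (simp only: power_Suc power_add)
        ultimately show ?thesis by linarith
      qed
    qed
  qed
qed

section \<open>Transfer to lists\<close>

primrec dec :: "v4 \<Rightarrow> nat" where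
  "dec V0 = 0" | "dec V1 = 1" | "dec V2 = 2" | "dec V3 = 3"

definition enc :: "nat \<Rightarrow> v4" where
  "enc k = (if k = 0 then V0 else if k = 1 then V1 else if k = 2 then V2 else V3)"

lemma enc_dec [simp]: "enc (dec a) = a"
  by (cases a) (simp_all add: enc_def)

lemma dec_enc [simp]: "k < 4 \<Longrightarrow> dec (enc k) = k"
  by (auto simp: enc_def)

lemma dec_less [simp]: "dec a < 4"
  by (cases a) simp_all

lemma dec_eq_iff [simp]: "dec a = dec b \<longleftrightarrow> a = b"
  by (metis enc_dec)

definition dlist :: "nat \<Rightarrow> (nat \<Rightarrow> v4) \<Rightarrow> nat list" where
  "dlist n x = map (\<lambda>i. dec (x i)) [0..<n]"

lemma length_dlist [simp]: "length (dlist n x) = n"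
  by (simp add: dlist_def)

lemma nth_dlist [simp]: "i < n \<Longrightarrow> dlist n x ! i = dec (x i)"
  by (simp add: dlist_def)

lemma dlist_in_words: "dlist n x \<in> words 4 n"
  by (auto simp: words_def dlist_def)

lemma dlist_upd: "dlist n (x(i := v)) = (dlist n x)[i := dec v]"
  by (rule nth_equalityI) (auto simp: nth_list_update)

lemma dlist_cong: "(\<And>i. i < n \<Longrightarrow> x i = y i) \<Longrightarrow> dlist n x = dlist n y"
  by (simp add: dlist_def)

context
  fixes n :: nat and f :: "nat list \<Rightarrow> nat"
  assumes qg: "quasigroup 4 n f"
begin

definition v4_op :: "(nat \<Rightarrow> v4) \<Rightarrow> v4" where
  "v4_op x = enc (f (dlist n x))"

lemma dec_v4_op: "dec (v4_op x) = f (dlist n x)"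
  using qg dlist_in_words [of n x] by (auto simp: v4_op_def quasigroup_def)

lemma latin_v4_op: "latin v4_op {0..<n}"
proof
  fix i x assume "i \<in> {0..<n}"
  then have i: "i < n" by simp
  show "bij (\<lambda>v. v4_op (x(i := v)))"
  proof (rule bij_v4I, rule injI)
    fix v v' assume eq: "v4_op (x(i := v)) = v4_op (x(i := v'))"
    \<comment> \<open>Position 0 holds the value, so coordinate \<open>i\<close> sits at
      \<open>Suc i\<close>; unique solvability there gives injectivity on the line.\<close>
    let ?\<alpha> = "dec (v4_op (x(i := v))) # dlist n x"
    have "?\<alpha> \<in> words 4 (n + 1)"
      using dlist_in_words [of n x] by (auto simp: words_def)
    moreover have "Suc i \<in> {0..n}"
      using i by simp
    ultimately have "\<exists>!t. t \<in> {0..<4} \<and> graph_vector f (?\<alpha>[Suc i := t])"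
      using qg unfolding quasigroup_def by blast
    moreover have "graph_vector f (?\<alpha>[Suc i := dec w])" if "v4_op (x(i := w)) = v4_op (x(i := v))" for w
      using that dec_v4_op [of "x(i := w)"] by (simp add: graph_vector_def dlist_upd)
    ultimately have "dec v = dec v'"
      using eq by (metis atLeastLessThan_iff dec_less zero_le)
    then show "v = v'" by simp
  qed
qed

definition transv :: "(nat \<Rightarrow> v4 \<Rightarrow> v4) \<Rightarrow> nat list set" where
  "transv \<sigma> = range (\<lambda>u. dec u # dlist n (\<lambda>i. \<sigma> i u))"

lemma transversal_transv:
  assumes "\<sigma> \<in> frames v4_op {0..<n} z"
  shows "transversal 4 n f (transv \<sigma>)"
proof -
  have pt: "dlist n (pt {0..<n} z \<sigma> u) = dlist n (\<lambda>i. \<sigma> i u)" for u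
    by (rule dlist_cong) (simp add: pt_def)
  have "f (dlist n (\<lambda>i. \<sigma> i u)) = dec u" for u
    using dec_v4_op [of "pt {0..<n} z \<sigma> u"] framesD(3) [OF assms, of u] by (simp add: pt)
  then have "\<forall>\<alpha>\<in>transv \<sigma>. graph_vector f \<alpha>"
    by (auto simp: transv_def graph_vector_def)
  moreover have "transv \<sigma> \<subseteq> words 4 (n + 1)"
    by (auto simp: transv_def words_def dlist_def)
  moreover have "card (transv \<sigma>) = 4"
    unfolding transv_def by (subst card_image) (auto simp: inj_def card_v4)
  moreover have "(dec u # dlist n (\<lambda>i. \<sigma> i u)) ! k \<noteq> (dec v # dlist n (\<lambda>i. \<sigma> i v)) ! k"
    if "u \<noteq> v" "k \<le> n" for u v k
  proof (cases k)
    case (Suc i)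
    then have "bij (\<sigma> i)"
      using framesD(2) [OF assms, of i] that by simp
    then show ?thesis
      using Suc that by (auto simp: bij_def inj_eq)
  qed (use that in simp)
  ultimately show ?thesis
    unfolding transversal_def by (auto simp: transv_def)
qed

text \<open>In a set \<open>transv \<sigma>\<close> the head \<open>dec u\<close> singles out one
  vector, so the unordered set still determines every \<open>\<sigma> i u\<close>.\<close>

lemma inj_on_transv: "inj_on transv (frames v4_op {0..<n} z)"
proof (rule inj_onI)
  fix \<sigma> \<tau>
  assume \<sigma>\<tau>: "\<sigma> \<in> frames v4_op {0..<n} z" "\<tau> \<in> frames v4_op {0..<n} z" and eq: "transv \<sigma> = transv \<tau>"
  show "\<sigma> = \<tau>"
  proof (rule extensionalityI [OF framesD(1) [OF \<sigma>\<tau>(1)] framesD(1) [OF \<sigma>\<tau>(2)]])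
    fix i assume i: "i \<in> {0..<n}"
    have "\<sigma> i u = \<tau> i u" for u
    proof -
      have "dec u # dlist n (\<lambda>i. \<sigma> i u) \<in> transv \<tau>"
        unfolding eq [symmetric] by (auto simp: transv_def)
      then have "dlist n (\<lambda>i. \<sigma> i u) = dlist n (\<lambda>i. \<tau> i u)"
        by (auto simp: transv_def)
      then have "dlist n (\<lambda>i. \<sigma> i u) ! i = dlist n (\<lambda>i. \<tau> i u) ! i"
        by simp
      then show ?thesis
        using i by simp
    qed
    then show "\<sigma> i = \<tau> i" by blast
  qed
qed

end

lemma finite_transversals: "finite {T. transversal 4 n f T}"
proof (rule finite_subset)
  show "{T. transversal 4 n f T} \<subseteq> Pow (words 4 (n + 1))"
    by (auto simp: transversal_def)
  have "words 4 (n + 1) = {xs. set xs \<subseteq> {0..<4} \<and> length xs = n + 1}"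
    by (auto simp: words_def)
  then show "finite (Pow (words 4 (n + 1)))"
    by (simp add: finite_lists_length_eq)
qed

theorem theorem8:
  fixes n :: nat and f :: "nat list \<Rightarrow> nat"
  assumes "odd n" and "quasigroup 4 n f"
  shows "card {T. transversal 4 n f T} \<ge> 8 ^ (n - 1)"
proof -
  let ?F = "frames (v4_op n f) {0..<n} (\<lambda>_. 0)"
  have "8 ^ (n - 1) \<le> card ?F"
    using card_frames_ge [OF latin_v4_op [OF assms(2)]] assms(1) by simp
  also have "\<dots> \<le> card {T. transversal 4 n f T}"
    using transversal_transv [OF assms(2)] inj_on_transv [OF assms(2)] finite_transversals
    by (intro card_inj_on_le [of "transv n"]) auto
  finally show ?thesis .
qed

end
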